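(* There are universal Martin-Löf tests $\mathcal U$ and $\mathcal W$ and a function $F$ (defined on $\mathrm{MLR}$) that is exactly $\mathcal U$-layerwise computable but not exactly $\mathcal W$-layerwise computable.
   Context: Work in Cantor space $2^\omega$ with Lebesgue measure $\lambda$. For $\sigma\in 2^{<\omega}$, $[\sigma]=\{X\in 2^\omega:\sigma\prec X\}$. A sequence $(\mathcal U_i)_{i\in\omega}$ of open subsets of $2^\omega$ is uniformly effectively open if $\{\langle i,\sigma\rangle : [\sigma]\subseteq\mathcal U_i\}$ is computably enumerable. A Martin-Löf (ML) test is a uniformly effectively open sequence $(\mathcal V_i)_{i\in\omega}$ with $\lambda(\mathcal V_i)\le 2^{-i}$; it is universal if $\bigcap_i\mathcal V'_i\subseteq\bigcap_i\mathcal V_i$ for every ML-test $\mathcal V'$. $\mathrm{MLR}$ is the set of Martin-Löf random sequences, which for universal $\mathcal U$ equals $2^\omega\setminus\bigcap_i\mathcal U_i$; for $X\in\mathrm{MLR}$, $\mathrm{rd}_{\mathcal U}(X)=\min\{i:X\notin\mathcal U_i\}$. Functions take values in $2^\omega$ or in $\omega$ (a number $n$ coded by the characteristic function of $\{n\}$). A function $f$ (defined at least on $\mathrm{MLR}$) is exactly $\mathcal U$-layerwise computable if there is a Turing functional $\Phi$ with $\Phi(\langle X,\mathrm{rd}_{\mathcal U}(X)\rangle)=f(X)$ for all $X\in\mathrm{MLR}$. *)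

theory Defs
  imports "HOL-Probability.Probability" "HOL-Library.Nat_Bijection"
begin

type_synonym cantor = "nat \<Rightarrow> bool"

definition cyl :: "bool list \<Rightarrow> cantor set" where
  "cyl \<sigma> = {X. \<forall>k<length \<sigma>. X k = \<sigma> ! k}"

definition cantor_open :: "cantor set \<Rightarrow> bool" where
  "cantor_open U \<longleftrightarrow> (\<forall>X\<in>U. \<exists>\<sigma>. X \<in> cyl \<sigma> \<and> cyl \<sigma> \<subseteq> U)"

definition lam :: "cantor measure" where
  "lam = PiM UNIV (\<lambda>_::nat. measure_pmf (pmf_of_set (UNIV :: bool set)))"

datatype rf = Zero | Succ | Proj nat | Comp rf "rf list" | PrimRec rf rf | Minim rf | Orc

definition arg0 :: "nat list \<Rightarrow> nat" where
  "arg0 xs = (case xs of [] \<Rightarrow> 0 | x # _ \<Rightarrow> x)"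

inductive ev :: "(nat \<Rightarrow> bool) \<Rightarrow> rf \<Rightarrow> nat list \<Rightarrow> nat \<Rightarrow> bool" for A where
  ev_zero: "ev A Zero xs 0"
| ev_succ: "ev A Succ xs (Suc (arg0 xs))"
| ev_proj: "i < length xs \<Longrightarrow> ev A (Proj i) xs (xs ! i)"
| ev_comp: "list_all2 (\<lambda>g y. ev A g xs y) gs ys \<Longrightarrow> ev A f ys z \<Longrightarrow> ev A (Comp f gs) xs z"
| ev_pr0: "ev A f xs z \<Longrightarrow> ev A (PrimRec f g) (0 # xs) z"
| ev_prS: "ev A (PrimRec f g) (n # xs) y \<Longrightarrow> ev A g (y # n # xs) z
           \<Longrightarrow> ev A (PrimRec f g) (Suc n # xs) z"
| ev_min: "ev A f (n # xs) 0 \<Longrightarrow> (\<forall>m<n. \<exists>k. ev A f (m # xs) (Suc k))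
           \<Longrightarrow> ev A (Minim f) xs n"
| ev_orc: "ev A Orc xs (if A (arg0 xs) then 1 else 0)"

definition ce :: "nat set \<Rightarrow> bool" where
  "ce S \<longleftrightarrow> (\<exists>f. \<forall>n. n \<in> S \<longleftrightarrow> (\<exists>y. ev (\<lambda>_. False) f [n] y))"

definition tf_computes :: "rf \<Rightarrow> cantor \<Rightarrow> cantor \<Rightarrow> bool" where
  "tf_computes Phi Z Y \<longleftrightarrow> (\<forall>n. ev Z Phi [n] (if Y n then 1 else 0))"

definition code_str :: "bool list \<Rightarrow> nat" where
  "code_str \<sigma> = list_encode (map (\<lambda>b. if b then 1 else 0) \<sigma>)"

definition unif_eff_open :: "(nat \<Rightarrow> cantor set) \<Rightarrow> bool" where
  "unif_eff_open U \<longleftrightarrow> (\<forall>i. cantor_open (U i)) \<and>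
     ce {prod_encode (i, code_str \<sigma>) | i \<sigma>. cyl \<sigma> \<subseteq> U i}"

definition mltest :: "(nat \<Rightarrow> cantor set) \<Rightarrow> bool" where
  "mltest V \<longleftrightarrow> unif_eff_open V \<and> (\<forall>i. emeasure lam (V i) \<le> ennreal ((1/2) ^ i))"

definition universal_mltest :: "(nat \<Rightarrow> cantor set) \<Rightarrow> bool" where
  "universal_mltest U \<longleftrightarrow> mltest U \<and>
     (\<forall>V. mltest V \<longrightarrow> (\<Inter>i. V i) \<subseteq> (\<Inter>i. U i))"

definition MLR :: "cantor set" where
  "MLR = {X. \<forall>V. mltest V \<longrightarrow> X \<notin> (\<Inter>i. V i)}"

definition rd :: "(nat \<Rightarrow> cantor set) \<Rightarrow> cantor \<Rightarrow> nat" where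
  "rd U X = (LEAST i. X \<notin> U i)"

text \<open>The pair \<langle>X, n\<rangle>: join of X with the characteristic function of {n}.\<close>
definition pair_seq_nat :: "cantor \<Rightarrow> nat \<Rightarrow> cantor" where
  "pair_seq_nat X n = (\<lambda>k. if even k then X (k div 2) else k div 2 = n)"

definition exactly_layerwise_computable :: "(nat \<Rightarrow> cantor set) \<Rightarrow> (cantor \<Rightarrow> cantor) \<Rightarrow> bool" where
  "exactly_layerwise_computable U f \<longleftrightarrow>
     (\<exists>Phi. \<forall>X\<in>MLR. tf_computes Phi (pair_seq_nat X (rd U X)) (f X))"

end

theory Submission
  imports Defs
begin

text \<open>Let \<open>V\<close> be a universal test and \<open>P\<close> the leftmost point outside \<open>V 1\<close>. The function is the
  deficiency \<open>rd U\<close> itself, which is trivially \<open>U\<close>-layerwise computable. Take \<open>U 0 = V 1\<close>,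
  \<open>W 0 = V (j + 1)\<close>, and later components from \<open>V\<close>. If \<open>rd U\<close> were \<open>W\<close>-layerwise computable, it
  would be continuous on the complement of \<open>W 0\<close>. But \<open>rd U P = 0\<close>, whereas every point to the left
  of \<open>P\<close> has positive deficiency, so it suffices that such points outside \<open>W 0\<close> accumulate at \<open>P\<close>.
  Otherwise some \<open>[\<rho>0]\<close> with \<open>\<rho>1\<close> a prefix of \<open>P\<close> is contained in \<open>V (j + 1)\<close>. The cylinders
  \<open>[\<rho>1]\<close> with \<open>[\<rho>0] \<subseteq> V (j + 1)\<close> have total measure at most twice that of \<open>V (j + 1)\<close>, hence
  form a Martin-Loef test; as \<open>P\<close> is random, it avoids this test for some \<open>j\<close>.\<close>

text \<open>The tests are aligned so that \<open>W i = U (Suc i)\<close>: outside \<open>W 0\<close>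
  the \<open>W\<close>-deficiency is constantly 0, so it carries no information on membership in
  \<open>V 1\<close>, which is what decides whether the \<open>U\<close>-deficiency is 0. Taking
  \<open>P\<close> leftmost puts the cylinder on the left of each right turn of \<open>P\<close>
  into \<open>V 1\<close>, and randomness makes right turns occur at arbitrary depth. Most of the
  work goes into effectiveness. A test must enumerate all cylinders contained in its components, not
  just a generating family; passing from generators to all contained cylinders takes compactness and
  a decision procedure for finite covers. A universal test needs all programs at once, which is
  achieved by a decidable predicate on coded derivations of \<open>ev\<close>.\<close>

section \<open>Determinism and finite use of oracle computations\<close>

inductive_cases ev_ZeroE: "ev A Zero xs y"
inductive_cases ev_SuccE: "ev A Succ xs y"
inductive_cases ev_ProjE: "ev A (Proj i) xs y"
inductive_cases ev_CompE: "ev A (Comp f gs) xs y"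
inductive_cases ev_PrimRec0E: "ev A (PrimRec f g) (0 # xs) y"
inductive_cases ev_PrimRecSucE: "ev A (PrimRec f g) (Suc n # xs) y"
inductive_cases ev_MinimE: "ev A (Minim f) xs y"
inductive_cases ev_OrcE: "ev A Orc xs y"

text \<open>\<open>ev\<close> is only a relation, so uniqueness of values has to be derived. For
  minimization, two different results would make the value at the smaller one both zero and a
  successor.\<close>

lemma ev_deterministic: "ev A f xs y \<Longrightarrow> ev A f xs z \<Longrightarrow> y = z"
proof (induction arbitrary: z rule: ev.induct)
  case (ev_comp xs gs ys f y)
  from ev_comp.prems obtain zs where zs: "list_all2 (\<lambda>g z. ev A g xs z) gs zs" "ev A f zs z"
    by (auto elim: ev_CompE)
  have "ys = zs"
    using ev_comp.IH(1) zs(1) by (auto simp: list_all2_conv_all_nth intro!: nth_equalityI)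
  with ev_comp.IH(2) zs(2) show ?case by blast
next
  case (ev_min f n xs)
  from ev_min.prems have z: "ev A f (z # xs) 0" "\<forall>m<z. \<exists>k. ev A f (m # xs) (Suc k)"
    by (auto elim: ev_MinimE)
  show ?case
  proof (rule linorder_cases[of n z])
    assume "n < z"
    with z(2) ev_min.IH(1) show ?thesis by fastforce
  next
    assume "z < n"
    with z(1) ev_min.IH(2) show ?thesis by fastforce
  qed
next
  case (ev_prS f g n xs y z')
  then show ?case by (metis ev_PrimRecSucE)
next
  case (ev_pr0 f xs z g)
  then show ?case by (meson ev_PrimRec0E)
qed (auto elim!: ev_ZeroE ev_SuccE ev_ProjE ev_OrcE)

lemma finite_uniform_bound:
  fixes Q :: "'a \<Rightarrow> nat \<Rightarrow> bool"
  assumes "finite I" and "\<And>i. i \<in> I \<Longrightarrow> \<exists>N. Q i N"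
    and mono: "\<And>i N M. Q i N \<Longrightarrow> N \<le> M \<Longrightarrow> Q i M"
  shows "\<exists>N. \<forall>i\<in>I. Q i N"
proof -
  obtain N where "\<And>i. i \<in> I \<Longrightarrow> Q i (N i)" using assms(2) by metis
  then have "\<forall>i\<in>I. Q i (Max (N ` I))"
    using \<open>finite I\<close> by (meson mono Max_ge finite_imageI imageI)
  then show ?thesis ..
qed

text \<open>A finite derivation contains finitely many oracle queries (the use principle). The
  continuity exploited in the final argument comes from here.\<close>

lemma ev_finite_use: "ev A f xs y \<Longrightarrow> \<exists>N. \<forall>B. (\<forall>k<N. A k = B k) \<longrightarrow> ev B f xs y"
proof (induction rule: ev.induct)
  case (ev_comp xs gs ys f z)
  let ?Q = "\<lambda>i N. \<forall>B. (\<forall>k<N. A k = B k) \<longrightarrow> ev B (gs ! i) xs (ys ! i)"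
  from ev_comp.IH(1) have len: "length gs = length ys" and "\<And>i. i < length gs \<Longrightarrow> \<exists>N. ?Q i N"
    by (auto simp: list_all2_conv_all_nth)
  then have "\<exists>N. \<forall>i\<in>{..<length gs}. ?Q i N"
    by (intro finite_uniform_bound[where Q = ?Q]) auto
  then obtain N where N: "\<forall>i<length gs. ?Q i N" by auto
  from ev_comp.IH(2) obtain M where M: "\<forall>B. (\<forall>k<M. A k = B k) \<longrightarrow> ev B f ys z" by blast
  have "ev B (Comp f gs) xs z" if "\<forall>k<max N M. A k = B k" for B
    using that N M len by (intro ev.ev_comp) (auto simp: list_all2_conv_all_nth)
  then show ?case by blast
next
  case (ev_min f n xs)
  let ?Q = "\<lambda>m N. \<exists>k. \<forall>B. (\<forall>k<N. A k = B k) \<longrightarrow> ev B f (m # xs) (Suc k)"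
  have "\<exists>N. \<forall>i\<in>{..<n}. ?Q i N"
  proof (rule finite_uniform_bound[where Q = ?Q])
    show "?Q i M" if "?Q i N" "N \<le> M" for i N M
      using that by (meson less_le_trans)
    show "\<exists>N. ?Q i N" if "i \<in> {..<n}" for i
      using ev_min.IH(2) that by (simp only: lessThan_iff) metis
  qed simp
  then obtain N where N: "\<And>m. m < n \<Longrightarrow> ?Q m N" by (auto simp only: lessThan_iff Ball_def)
  from ev_min.IH(1) obtain M where M: "\<forall>B. (\<forall>k<M. A k = B k) \<longrightarrow> ev B f (n # xs) 0" by blast
  have "ev B (Minim f) xs n" if "\<forall>k<max N M. A k = B k" for B
  proof (rule ev.ev_min)
    show "ev B f (n # xs) 0" using that M by simp
    have "\<forall>k<N. A k = B k" using that by simp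
    then show "\<forall>m<n. \<exists>k. ev B f (m # xs) (Suc k)" using N by blast
  qed
  then show ?case by blast
next
  case (ev_prS f g n xs y z)
  then obtain N M where "\<forall>B. (\<forall>k<N. A k = B k) \<longrightarrow> ev B (PrimRec f g) (n # xs) y"
    "\<forall>B. (\<forall>k<M. A k = B k) \<longrightarrow> ev B g (y # n # xs) z" by blast
  then have "ev B (PrimRec f g) (Suc n # xs) z" if "\<forall>k<max N M. A k = B k" for B
    using that by (intro ev.ev_prS) auto
  then show ?case by blast
next
  case (ev_orc xs)
  have "ev B Orc xs (if A (arg0 xs) then 1 else 0)" if "\<forall>k<Suc (arg0 xs). A k = B k" for B
    using that ev.ev_orc[of B xs] by auto
  then show ?case by blast
qed (blast intro: ev.intros)+

section \<open>Total recursive functions and decidable predicates\<close>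

abbreviation ev0 :: "rf \<Rightarrow> nat list \<Rightarrow> nat \<Rightarrow> bool" where
  "ev0 \<equiv> ev (\<lambda>_. False)"

text \<open>Functions and predicates of several arguments are handled by iterating the pairing \<open>pair\<close>:
  the unary classes \<open>rec1\<close> and \<open>decp\<close> then have syntax-directed closure rules.\<close>

definition rec1 :: "(nat \<Rightarrow> nat) \<Rightarrow> bool" where
  "rec1 f \<longleftrightarrow> (\<exists>r. \<forall>x. ev0 r [x] (f x))"

definition rec2 :: "(nat \<Rightarrow> nat \<Rightarrow> nat) \<Rightarrow> bool" where
  "rec2 h \<longleftrightarrow> (\<exists>r. \<forall>x y. ev0 r [x, y] (h x y))"

lemma ev_projI: "i < length xs \<Longrightarrow> y = xs ! i \<Longrightarrow> ev A (Proj i) xs y"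
  by (simp add: ev_proj)

lemma ev_comp1: "ev A g xs y \<Longrightarrow> ev A f [y] z \<Longrightarrow> ev A (Comp f [g]) xs z"
  by (rule ev_comp[of _ _ _ "[y]"]) auto

lemma ev_comp2: "ev A g xs y \<Longrightarrow> ev A h xs y' \<Longrightarrow> ev A f [y, y'] z \<Longrightarrow> ev A (Comp f [g, h]) xs z"
  by (rule ev_comp[of _ _ _ "[y, y']"]) auto

lemma rec1_id: "rec1 (\<lambda>x. x)"
  unfolding rec1_def by (rule exI[of _ "Proj 0"]) (auto intro: ev_projI)

lemma rec1_comp: "rec1 f \<Longrightarrow> rec1 g \<Longrightarrow> rec1 (\<lambda>x. f (g x))"
  unfolding rec1_def by (meson ev_comp1)

lemma rec1_comp2: "rec2 h \<Longrightarrow> rec1 f \<Longrightarrow> rec1 g \<Longrightarrow> rec1 (\<lambda>x. h (f x) (g x))"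
  unfolding rec1_def rec2_def by (meson ev_comp2)

lemma rec2_comp1: "rec1 f \<Longrightarrow> rec2 g \<Longrightarrow> rec2 (\<lambda>x y. f (g x y))"
  unfolding rec1_def rec2_def by (meson ev_comp1)

lemma rec2_comp2: "rec2 h \<Longrightarrow> rec2 f \<Longrightarrow> rec2 g \<Longrightarrow> rec2 (\<lambda>x y. h (f x y) (g x y))"
  unfolding rec1_def rec2_def by (meson ev_comp2)

lemma rec2_proj: "rec2 (\<lambda>x y. x)" "rec2 (\<lambda>x y. y)"
  unfolding rec2_def
  by (rule exI[of _ "Proj 0"], auto intro: ev_projI) (rule exI[of _ "Proj 1"], auto intro: ev_projI)

lemma rec1_Suc: "rec1 Suc"
proof -
  have "ev0 Succ [x] (Suc x)" for x using ev_succ[of _ "[x]"] by (simp add: arg0_def)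
  then show ?thesis unfolding rec1_def by blast
qed

lemma rec1_const: "rec1 (\<lambda>x. c)"
proof (induction c)
  case 0
  show ?case unfolding rec1_def using ev_zero by blast
next
  case (Suc c)
  then show ?case using rec1_comp[OF rec1_Suc] by blast
qed

text \<open>The step function is given as a raw program because it has three arguments;
  \<open>[y, n, x]\<close> is the order in which \<open>ev_prS\<close> passes previous value,
  counter and parameter.\<close>

lemma rec2_primrec:
  assumes "rec1 f" and "\<exists>r. \<forall>y n x. ev0 r [y, n, x] (g n y x)"
  shows "rec2 (\<lambda>n x. rec_nat (f x) (\<lambda>n y. g n y x) n)"
proof -
  obtain rf rg where f: "\<And>x. ev0 rf [x] (f x)" and g: "\<And>y n x. ev0 rg [y, n, x] (g n y x)"
    using assms unfolding rec1_def by blast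
  have "ev0 (PrimRec rf rg) [n, x] (rec_nat (f x) (\<lambda>n y. g n y x) n)" for n x
    by (induction n) (auto intro!: ev_pr0 f intro: ev_prS g)
  then show ?thesis unfolding rec2_def by blast
qed

lemma rec2_primrec2:
  assumes "rec1 f" and "rec2 h"
  shows "rec2 (\<lambda>n x. rec_nat (f x) (\<lambda>n y. h y x) n)"
proof (rule rec2_primrec[OF assms(1)])
  obtain r where r: "\<And>x y. ev0 r [x, y] (h x y)" using assms unfolding rec2_def by blast
  have "ev0 (Comp r [Proj 0, Proj 2]) [y, n, x] (h y x)" for y n x
    by (rule ev_comp2[OF _ _ r]) (auto intro!: ev_projI)
  then show "\<exists>r. \<forall>y n x. ev0 r [y, n, x] (h y x)" by blast
qed

lemma rec2_add: "rec2 (+)"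
proof -
  have "rec2 (\<lambda>n x. rec_nat x (\<lambda>n y. Suc y) n)"
    by (rule rec2_primrec2[OF rec1_id rec2_comp1[OF rec1_Suc rec2_proj(1)]])
  also have "(\<lambda>n x. rec_nat x (\<lambda>n y. Suc y) n) = (+)"
  proof (intro ext)
    show "rec_nat x (\<lambda>n y. Suc y) n = n + x" for n x :: nat by (induction n) auto
  qed
  finally show ?thesis .
qed

lemma rec2_mult: "rec2 (*)"
proof -
  have "rec2 (\<lambda>n x. rec_nat 0 (\<lambda>n y. y + x) n)"
    by (rule rec2_primrec2[OF rec1_const rec2_add])
  also have "(\<lambda>n x. rec_nat 0 (\<lambda>n y. y + x) n) = (*)"
  proof (intro ext)
    show "rec_nat 0 (\<lambda>n y. y + x) n = n * x" for n x :: nat by (induction n) auto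
  qed
  finally show ?thesis .
qed

lemma rec1_primrec_closed:
  assumes "\<exists>r. \<forall>y n x. ev0 r [y, n, x] (g n y)"
  shows "rec1 (rec_nat c g)"
  using rec1_comp2[OF rec2_primrec[OF rec1_const assms] rec1_id rec1_id] by simp

lemma rec1_pred: "rec1 (\<lambda>n. n - 1)"
proof -
  have "ev0 (Proj 1) [y, n, x] n" for y n x by (auto intro: ev_projI)
  then have "rec1 (rec_nat 0 (\<lambda>n y. n))"
    by (intro rec1_primrec_closed) blast
  also have "rec_nat 0 (\<lambda>n y. n) = (\<lambda>n. n - 1)"
  proof
    show "rec_nat 0 (\<lambda>n y. n) n = n - 1" for n by (cases n) auto
  qed
  finally show ?thesis .
qed

lemma rec2_sub: "rec2 (-)"
proof -
  have "rec2 (\<lambda>n x. rec_nat x (\<lambda>n y. y - 1) n)"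
    by (rule rec2_primrec2[OF rec1_id rec2_comp1[OF rec1_pred rec2_proj(1)]])
  also have "(\<lambda>n x. rec_nat x (\<lambda>n y. y - 1) n) = (\<lambda>n x. x - n)"
  proof (intro ext)
    show "rec_nat x (\<lambda>n y. y - 1) n = x - n" for n x :: nat by (induction n) auto
  qed
  finally have "rec2 (\<lambda>n x. x - n)" .
  from rec2_comp2[OF this rec2_proj(2) rec2_proj(1)] show ?thesis .
qed

lemma rec1_triangle: "rec1 triangle"
proof -
  obtain r where r: "\<And>x y. ev0 r [x, y] (x + Suc y)"
    using rec2_comp2[OF rec2_add rec2_proj(1) rec2_comp1[OF rec1_Suc rec2_proj(2)]]
    unfolding rec2_def by blast
  have "ev0 (Comp r [Proj 0, Proj 1]) [y, n, x] (y + Suc n)" for y n x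
    by (rule ev_comp2[OF _ _ r]) (auto intro!: ev_projI)
  then have "rec1 (rec_nat 0 (\<lambda>n y. y + Suc n))"
    by (intro rec1_primrec_closed) blast
  also have "rec_nat 0 (\<lambda>n y. y + Suc n) = triangle"
  proof
    show "rec_nat 0 (\<lambda>n y. y + Suc n) n = triangle n" for n by (induction n) auto
  qed
  finally show ?thesis .
qed

lemma rec1_Least0:
  assumes "rec2 g" and ex: "\<And>x. \<exists>m. g m x = 0"
  shows "rec1 (\<lambda>x. LEAST m. g m x = 0)"
proof -
  obtain r where r: "\<And>x y. ev0 r [x, y] (g x y)" using assms unfolding rec2_def by blast
  have "ev0 (Minim r) [x] (LEAST m. g m x = 0)" for x
  proof (rule ev_min)
    show "ev0 r [LEAST m. g m x = 0, x] 0"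
      using r[of "LEAST m. g m x = 0" x] LeastI_ex[OF ex[of x]] by simp
    show "\<forall>m<LEAST m. g m x = 0. \<exists>k. ev0 r [m, x] (Suc k)"
      using r not_less_Least by (metis not0_implies_Suc)
  qed
  then show ?thesis unfolding rec1_def by blast
qed

section \<open>Cantor pairing and its inverse\<close>

definition pair :: "nat \<Rightarrow> nat \<Rightarrow> nat" where "pair x y = prod_encode (x, y)"
definition pfst :: "nat \<Rightarrow> nat" where "pfst z = fst (prod_decode z)"
definition psnd :: "nat \<Rightarrow> nat" where "psnd z = snd (prod_decode z)"

lemma pair_simps [simp]: "pfst (pair x y) = x" "psnd (pair x y) = y" "pair (pfst z) (psnd z) = z"
  "pair x y = pair x' y' \<longleftrightarrow> x = x' \<and> y = y'"
  by (auto simp: pair_def pfst_def psnd_def)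

lemma rec2_pair: "rec2 pair"
  using rec2_comp2[OF rec2_add rec2_comp1[OF rec1_triangle rec2_add] rec2_proj(1)]
  unfolding pair_def prod_encode_def by simp

text \<open>Cantor pairing sends \<open>(x, y)\<close> to \<open>triangle (x + y) + x\<close>, and
  \<open>diag\<close> recovers the antidiagonal \<open>x + y\<close>. The condition means
  \<open>z < triangle (Suc s)\<close>; it is written as a vanishing truncated difference to fit
  \<open>rec1_Least0\<close>.\<close>

definition diag :: "nat \<Rightarrow> nat" where "diag z = (LEAST s. Suc z - triangle (Suc s) = 0)"

lemma diag_pair: "diag (pair x y) = x + y"
  unfolding diag_def
proof (rule Least_equality)
  show "Suc (pair x y) - triangle (Suc (x + y)) = 0"
    by (simp add: pair_def prod_encode_def)
next
  fix s assume "Suc (pair x y) - triangle (Suc s) = 0"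
  then have s: "triangle (x + y) < triangle (Suc s)"
    by (simp add: pair_def prod_encode_def)
  have "mono triangle"
    unfolding triangle_def by (intro monoI div_le_mono mult_le_mono Suc_leI) auto
  with s have "x + y < Suc s" by (meson monoD not_le)
  then show "x + y \<le> s" by simp
qed

lemma rec1_diag: "rec1 diag"
  unfolding diag_def
proof (rule rec1_Least0)
  show "rec2 (\<lambda>s z. Suc z - triangle (Suc s))"
    by (intro rec2_comp2[OF rec2_sub] rec2_comp1[OF rec1_Suc] rec2_comp1[OF rec1_triangle] rec2_proj)
  have "z < triangle (Suc z)" for z by (induction z) auto
  then show "\<exists>s. Suc z - triangle (Suc s) = 0" for z
    by (metis Suc_leI diff_is_0_eq)
qed

lemma rec1_pfst: "rec1 pfst"
proof -
  have "pfst z = z - triangle (diag z)" for z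
    using diag_pair[of "pfst z" "psnd z"] pair_simps(3)[of z]
    by (simp add: pair_def prod_encode_def)
  then show ?thesis
    using rec1_comp2[OF rec2_sub rec1_id rec1_comp[OF rec1_triangle rec1_diag]] by presburger
qed

lemma rec1_psnd: "rec1 psnd"
proof -
  have "psnd z = diag z - pfst z" for z
    using diag_pair[of "pfst z" "psnd z"] by simp
  then show ?thesis
    using rec1_comp2[OF rec2_sub rec1_diag rec1_pfst] by presburger
qed

section \<open>Closure rules for unary functions and decidable predicates\<close>

named_theorems rec_intros

lemmas [rec_intros] = rec1_id rec1_const rec1_comp[OF rec1_Suc] rec1_comp[OF rec1_pfst]
  rec1_comp[OF rec1_psnd] rec1_comp2[OF rec2_pair] rec1_comp2[OF rec2_add] rec1_comp2[OF rec2_mult]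
  rec1_comp2[OF rec2_sub]

lemma rec1_rec2: 
  assumes "rec1 (\<lambda>z. f (pfst z) (psnd z))" shows "rec2 f"
  using rec2_comp1[OF assms rec2_pair] by simp

text \<open>The step function reads counter, previous value and parameter off one coded triple, so
  that all hypotheses are unary; the projections in the program permute \<open>[y, k, x]\<close>
  into that triple.\<close>

lemma rec1_rec_nat [rec_intros]:
  assumes "rec1 f" "rec1 (\<lambda>z. g (pfst z) (pfst (psnd z)) (psnd (psnd z)))" "rec1 n"
  shows "rec1 (\<lambda>x. rec_nat (f x) (\<lambda>k y. g k y x) (n x))"
proof -
  obtain rg where rg: "\<And>z. ev0 rg [z] (g (pfst z) (pfst (psnd z)) (psnd (psnd z)))"
    using assms(2) unfolding rec1_def by blast
  obtain rp where rp: "\<And>x y. ev0 rp [x, y] (pair x y)" using rec2_pair unfolding rec2_def by blast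
  let ?r = "Comp rg [Comp rp [Proj 1, Comp rp [Proj 0, Proj 2]]]"
  have "ev0 ?r [y, k, x] (g k y x)" for y k x
  proof (rule ev_comp1)
    show "ev0 rg [pair k (pair y x)] (g k y x)" using rg[of "pair k (pair y x)"] by simp
    show "ev0 (Comp rp [Proj 1, Comp rp [Proj 0, Proj 2]]) [y, k, x] (pair k (pair y x))"
      by (rule ev_comp2[OF _ ev_comp2 rp]) (auto intro!: ev_projI rp)
  qed
  then have "\<exists>r. \<forall>y k x. ev0 r [y, k, x] (g k y x)" by blast
  from rec1_comp2[OF rec2_primrec[OF assms(1) this] assms(3) rec1_id] show ?thesis .
qed

definition decp :: "(nat \<Rightarrow> bool) \<Rightarrow> bool" where
  "decp P \<longleftrightarrow> rec1 (\<lambda>x. if P x then 1 else 0)"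

lemma decp_cong_rec1: "rec1 f \<Longrightarrow> (\<And>x. f x = (if P x then 1 else 0)) \<Longrightarrow> decp P"
  unfolding decp_def by (rule subst[where P = rec1]) auto

lemma decp_le [rec_intros]: "rec1 f \<Longrightarrow> rec1 g \<Longrightarrow> decp (\<lambda>x. f x \<le> g x)"
  by (rule decp_cong_rec1[of "\<lambda>x. 1 - (f x - g x)"]) (auto intro!: rec_intros)

lemma decp_not [rec_intros]: "decp P \<Longrightarrow> decp (\<lambda>x. \<not> P x)"
  by (rule decp_cong_rec1[of "\<lambda>x. 1 - (if P x then 1 else 0)"])
    (auto intro!: rec_intros simp: decp_def simp del: One_nat_def)

lemma decp_conj [rec_intros]: "decp P \<Longrightarrow> decp Q \<Longrightarrow> decp (\<lambda>x. P x \<and> Q x)"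
  by (rule decp_cong_rec1[of "\<lambda>x. (if P x then 1 else 0) * (if Q x then 1 else 0)"])
    (auto intro!: rec_intros simp: decp_def simp del: One_nat_def)

lemma decp_disj [rec_intros]: "decp P \<Longrightarrow> decp Q \<Longrightarrow> decp (\<lambda>x. P x \<or> Q x)"
  using decp_not[OF decp_conj[OF decp_not decp_not]] by auto

lemma decp_imp [rec_intros]: "decp P \<Longrightarrow> decp Q \<Longrightarrow> decp (\<lambda>x. P x \<longrightarrow> Q x)"
  unfolding imp_conv_disj by (intro decp_disj decp_not)

lemma decp_eq [rec_intros]: "rec1 f \<Longrightarrow> rec1 g \<Longrightarrow> decp (\<lambda>x. f x = g x)"
  using decp_conj[OF decp_le decp_le, of f g g f] by (simp add: eq_iff)

lemma decp_less [rec_intros]: "rec1 f \<Longrightarrow> rec1 g \<Longrightarrow> decp (\<lambda>x. f x < g x)"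
  using decp_not[OF decp_le, of g f] by (simp add: not_le)

lemma decp_comp: "decp P \<Longrightarrow> rec1 f \<Longrightarrow> decp (\<lambda>x. P (f x))"
  unfolding decp_def by (rule rec1_comp)

lemma decp_comp2: "decp (\<lambda>z. P (pfst z) (psnd z)) \<Longrightarrow> rec1 f \<Longrightarrow> rec1 g \<Longrightarrow> decp (\<lambda>x. P (f x) (g x))"
  using decp_comp[of "\<lambda>z. P (pfst z) (psnd z)" "\<lambda>x. pair (f x) (g x)"]
  by (simp add: rec1_comp2[OF rec2_pair])

lemma rec1_if [rec_intros]:
  assumes "decp P" "rec1 f" "rec1 g" shows "rec1 (\<lambda>x. if P x then f x else g x)"
proof -
  have "rec1 (\<lambda>x. (if P x then 1 else 0) * f x + (1 - (if P x then 1 else 0)) * g x)"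
    using assms by (intro rec_intros) (auto simp: decp_def)
  also have "(\<lambda>x. (if P x then 1 else 0) * f x + (1 - (if P x then 1 else 0)) * g x)
      = (\<lambda>x. if P x then f x else g x)" by auto
  finally show ?thesis .
qed

lemma rec1_Least:
  assumes "decp (\<lambda>z. P (pfst z) (psnd z))" and "\<And>x. \<exists>m. P m x"
  shows "rec1 (\<lambda>x. LEAST m. P m x)"
proof -
  have "rec1 (\<lambda>x. LEAST m. (if P m x then 0 else 1::nat) = 0)"
    using assms by (intro rec1_Least0 rec1_rec2 rec_intros) auto
  moreover have "(if P m x then 0 else 1::nat) = 0 \<longleftrightarrow> P m x" for m x by simp
  ultimately show ?thesis by (simp only:)
qed

text \<open>Bounded search is run as a total minimization: it stops at \<open>b x\<close> at the
  latest, and stopping strictly earlier means that a witness was found.\<close>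

lemma decp_bex [rec_intros]:
  assumes P: "decp (\<lambda>z. P (pfst z) (psnd z))" and b: "rec1 b"
  shows "decp (\<lambda>x. \<exists>m<b x. P m x)"
proof -
  let ?l = "\<lambda>x. LEAST m. P m x \<or> b x \<le> m"
  have "rec1 ?l"
    by (rule rec1_Least) (auto intro!: rec_intros P rec1_comp[OF b])
  then have "decp (\<lambda>x. ?l x < b x)" by (intro rec_intros b)
  moreover have "?l x < b x \<longleftrightarrow> (\<exists>m<b x. P m x)" for x
  proof
    assume "?l x < b x"
    then show "\<exists>m<b x. P m x" using LeastI[of "\<lambda>m. P m x \<or> b x \<le> m" "b x"] by auto
  next
    assume "\<exists>m<b x. P m x"
    then obtain m where "m < b x" "P m x" by blast
    then show "?l x < b x" using Least_le[of "\<lambda>m. P m x \<or> b x \<le> m" m] by simp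
  qed
  ultimately show ?thesis by simp
qed

lemma decp_ball [rec_intros]:
  assumes P: "decp (\<lambda>z. P (pfst z) (psnd z))" and b: "rec1 b"
  shows "decp (\<lambda>x. \<forall>m<b x. P m x)"
  using decp_not[OF decp_bex[OF decp_not[OF P] b]] by auto

text \<open>Measures of finite unions of cylinders are compared later by counting binary words; this
  makes such counts recursive.\<close>

lemma rec1_count [rec_intros]:
  assumes P: "decp (\<lambda>z. P (pfst z) (psnd z))" and b: "rec1 b"
  shows "rec1 (\<lambda>x. card {m. m < b x \<and> P m x})"
proof -
  have "rec1 (\<lambda>x. rec_nat 0 (\<lambda>k y. y + (if P k x then 1 else 0)) (b x))"
    by (intro rec_intros b decp_comp2[OF P])
  moreover have "rec_nat 0 (\<lambda>k y. y + (if P k x then 1 else 0)) n = card {m. m < n \<and> P m x}" for n x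
  proof (induction n)
    case (Suc n)
    have "{m. m < Suc n \<and> P m x} = {m. m < n \<and> P m x} \<union> (if P n x then {n} else {})"
      by (auto simp: less_Suc_eq)
    with Suc show ?case by auto
  qed simp
  ultimately show ?thesis by simp
qed

lemma rec1_power2 [rec_intros]: "rec1 f \<Longrightarrow> rec1 (\<lambda>x. 2 ^ f x)"
proof -
  assume f: "rec1 f"
  have "rec1 (\<lambda>x. rec_nat 1 (\<lambda>k y. 2 * y) (f x))" by (intro rec_intros f)
  moreover have "rec_nat 1 (\<lambda>k y. 2 * y) n = (2::nat) ^ n" for n by (induction n) auto
  ultimately show ?thesis by simp
qed

lemma decp_bit [rec_intros]:
  assumes "rec1 f" "rec1 g" shows "decp (\<lambda>x. bit (f x) (g x))"
proof -
  let ?P = "\<lambda>w k. \<exists>q<Suc w. \<exists>r<2 ^ k. w = 2 ^ k * (2 * q + 1) + r"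
  have "bit w k \<longleftrightarrow> ?P w k" for w k :: nat
  proof
    assume "bit w k"
    then obtain q where q: "w div 2 ^ k = 2 * q + 1" by (auto simp: bit_iff_odd elim: oddE)
    have w: "w = 2 ^ k * (2 * q + 1) + w mod 2 ^ k" using q by (metis mult_div_mod_eq)
    have "q < Suc w" using q by (metis div_le_dividend le_add1 le_imp_less_Suc le_trans mult_2 add.assoc)
    with w show "?P w k" by (meson mod_less_divisor zero_less_numeral zero_less_power)
  next
    assume "?P w k"
    then obtain q r where "r < 2 ^ k" "w = 2 ^ k * (2 * q + 1) + r" by blast
    then have "w div 2 ^ k = 2 * q + 1"
      using div_mult_self4[of "2 ^ k" "2 * q + 1" r] by simp
    then show "bit w k" by (simp add: bit_iff_odd)
  qed
  moreover have "decp (\<lambda>x. ?P (f x) (g x))"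
    by (intro rec_intros rec1_comp[OF assms(1)] rec1_comp[OF assms(2)])
  ultimately show ?thesis by simp
qed

section \<open>A universal computation predicate\<close>

text \<open>List operations on codes with respect to \<^const>\<open>list_encode\<close>; \<open>nthc\<close> is \<open>0\<close> out of range.\<close>

definition hdc :: "nat \<Rightarrow> nat" where "hdc c = pfst (c - 1)"
definition tlc :: "nat \<Rightarrow> nat" where "tlc c = psnd (c - 1)"
definition consc :: "nat \<Rightarrow> nat \<Rightarrow> nat" where "consc x c = Suc (pair x c)"
definition dropc :: "nat \<Rightarrow> nat \<Rightarrow> nat" where "dropc k c = rec_nat c (\<lambda>_. tlc) k"
definition nthc :: "nat \<Rightarrow> nat \<Rightarrow> nat" where "nthc c k = hdc (dropc k c)"
definition lenc :: "nat \<Rightarrow> nat" where "lenc c = (LEAST k. dropc k c = 0)"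

text \<open>Gives the code 0 of the empty list head 0 and tail 0, so the coded list operations are
  total and behave well past the end of a list.\<close>

lemma prod_decode_0: "prod_decode 0 = (0, 0)"
  by (simp add: prod_decode_def prod_decode_aux.simps)

lemma hdc_encode: "hdc (list_encode xs) = (case xs of [] \<Rightarrow> 0 | x # _ \<Rightarrow> x)"
  by (cases xs) (auto simp: hdc_def pfst_def prod_decode_0)

lemma tlc_encode: "tlc (list_encode xs) = list_encode (tl xs)"
  by (cases xs) (auto simp: tlc_def psnd_def prod_decode_0)

lemma consc_encode: "consc x (list_encode xs) = list_encode (x # xs)"
  by (simp add: consc_def pair_def)

lemma dropc_encode: "dropc k (list_encode xs) = list_encode (drop k xs)"
  unfolding dropc_def by (induction k) (simp_all add: tlc_encode drop_Suc tl_drop)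

lemma nthc_encode: "nthc (list_encode xs) k = (if k < length xs then xs ! k else 0)"
  unfolding nthc_def dropc_encode hdc_encode
  by (simp add: hd_drop_conv_nth[symmetric] hd_def split: list.split)

lemma list_encode_eq_0: "list_encode xs = 0 \<longleftrightarrow> xs = []" "0 < list_encode xs \<longleftrightarrow> xs \<noteq> []"
  by (cases xs; auto)+

lemma lenc_encode: "lenc (list_encode xs) = length xs"
  unfolding lenc_def dropc_encode list_encode_eq_0 by (intro Least_equality) auto

lemma nthc_decode: "nthc c k = (if k < length (list_decode c) then list_decode c ! k else 0)"
  using nthc_encode[of "list_decode c" k] by simp

lemma lenc_decode: "lenc c = length (list_decode c)"
  using lenc_encode[of "list_decode c"] by simp

lemma rec1_hdc [rec_intros]: "rec1 f \<Longrightarrow> rec1 (\<lambda>x. hdc (f x))"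
  unfolding hdc_def by (intro rec_intros)

lemma rec1_tlc [rec_intros]: "rec1 f \<Longrightarrow> rec1 (\<lambda>x. tlc (f x))"
  unfolding tlc_def by (intro rec_intros)

lemma rec1_consc [rec_intros]: "rec1 f \<Longrightarrow> rec1 g \<Longrightarrow> rec1 (\<lambda>x. consc (f x) (g x))"
  unfolding consc_def by (intro rec_intros)

lemma rec1_dropc [rec_intros]: "rec1 f \<Longrightarrow> rec1 g \<Longrightarrow> rec1 (\<lambda>x. dropc (f x) (g x))"
  unfolding dropc_def by (intro rec_intros)

lemma rec1_nthc [rec_intros]: "rec1 f \<Longrightarrow> rec1 g \<Longrightarrow> rec1 (\<lambda>x. nthc (f x) (g x))"
  unfolding nthc_def by (intro rec_intros)

lemma rec1_lenc [rec_intros]: "rec1 f \<Longrightarrow> rec1 (\<lambda>x. lenc (f x))"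
proof -
  have "rec1 lenc"
    unfolding lenc_def
  proof (rule rec1_Least)
    show "decp (\<lambda>z. dropc (pfst z) (psnd z) = 0)" by (intro rec_intros)
    show "\<exists>k. dropc k c = 0" for c
      using dropc_encode[of "length (list_decode c)" "list_decode c"] by auto
  qed
  then show "rec1 f \<Longrightarrow> rec1 (\<lambda>x. lenc (f x))" by (rule rec1_comp)
qed

section \<open>Coded programs and one-step inferences between coded assertions\<close>

fun enc :: "rf \<Rightarrow> nat" where
  "enc Zero = pair 0 0"
| "enc Succ = pair 1 0"
| "enc (Proj i) = pair 2 i"
| "enc (Comp f gs) = pair 3 (pair (enc f) (list_encode (map enc gs)))"
| "enc (PrimRec f g) = pair 4 (pair (enc f) (enc g))"
| "enc (Minim f) = pair 5 (enc f)"
| "enc Orc = pair 6 0"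

text \<open>Stands for the assertion that the program with code \<open>e\<close>, run on the
  argument list with code \<open>x\<close>, returns \<open>y\<close>.\<close>

definition trip :: "nat \<Rightarrow> nat \<Rightarrow> nat \<Rightarrow> nat" where
  "trip e x y = pair e (pair x y)"

lemma trip_simps [simp]: "pfst (trip e x y) = e" "pfst (psnd (trip e x y)) = x"
  "psnd (psnd (trip e x y)) = y" "trip (pfst t) (pfst (psnd t)) (psnd (psnd t)) = t"
  by (simp_all add: trip_def)

text \<open>Here and in the next two definitions \<open>b\<close> is a program code stripped of its
  tag, \<open>S\<close> holds of the assertions already available, and \<open>Q\<close> limits the
  search for intermediate values. In this one \<open>ys\<close> codes the values of the inner
  functions.\<close>

definition comp_step :: "nat set \<Rightarrow> (nat \<Rightarrow> bool) \<Rightarrow> nat \<Rightarrow> nat \<Rightarrow> nat \<Rightarrow> bool" where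
  "comp_step Q S b x y \<longleftrightarrow> (\<exists>ys\<in>Q. S (trip (pfst b) ys y) \<and> lenc ys = lenc (psnd b) \<and>
     (\<forall>k<lenc ys. S (trip (nthc (psnd b) k) x (nthc ys k))))"

definition primrec_step :: "nat set \<Rightarrow> (nat \<Rightarrow> bool) \<Rightarrow> nat \<Rightarrow> nat \<Rightarrow> nat \<Rightarrow> bool" where
  "primrec_step Q S b x y \<longleftrightarrow> x \<noteq> 0 \<and>
     (hdc x = 0 \<and> S (trip (pfst b) (tlc x) y) \<or>
      0 < hdc x \<and> (\<exists>y'\<in>Q. S (trip (pair 4 b) (consc (hdc x - 1) (tlc x)) y') \<and>
        S (trip (psnd b) (consc y' (consc (hdc x - 1) (tlc x))) y)))"

definition minim_step :: "nat set \<Rightarrow> (nat \<Rightarrow> bool) \<Rightarrow> nat \<Rightarrow> nat \<Rightarrow> nat \<Rightarrow> bool" where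
  "minim_step Q S b x y \<longleftrightarrow> S (trip b (consc y x) 0) \<and> (\<forall>m<y. \<exists>v\<in>Q. S (trip b (consc m x) (Suc v)))"

text \<open>The triple \<open>t\<close> follows from triples satisfying \<open>S\<close> by one rule of \<^const>\<open>ev\<close>;
  the existential quantifiers range over \<open>Q\<close> so that they can be bounded.\<close>

definition just :: "nat set \<Rightarrow> (nat \<Rightarrow> bool) \<Rightarrow> nat \<Rightarrow> bool" where
  "just Q S t \<longleftrightarrow> (let tag = pfst (pfst t); b = psnd (pfst t); x = pfst (psnd t); y = psnd (psnd t) in
     tag = 0 \<and> y = 0 \<or>
     tag = 1 \<and> y = Suc (nthc x 0) \<or>
     tag = 2 \<and> b < lenc x \<and> y = nthc x b \<or>
     tag = 3 \<and> comp_step Q S b x y \<or>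
     tag = 4 \<and> primrec_step Q S b x y \<or>
     tag = 5 \<and> minim_step Q S b x y \<or>
     tag = 6 \<and> y = 0)"

text \<open>Quantifying over the programs with the given code takes the place of a decoder; an
  assertion about a number that codes no program is vacuously sound.\<close>

definition sound :: "nat \<Rightarrow> bool" where
  "sound t \<longleftrightarrow> (\<forall>f. pfst t = enc f \<longrightarrow> ev0 f (list_decode (pfst (psnd t))) (psnd (psnd t)))"

text \<open>Each tag of \<open>just\<close> mirrors the introduction rules of \<open>ev\<close> for
  one constructor, with the everywhere false oracle; hence an oracle query must return 0.\<close>

lemma just_sound:
  assumes S: "\<And>s. S s \<Longrightarrow> sound s" and t: "just UNIV S t"
  shows "sound t"
  unfolding sound_def
proof (intro allI impI)
  fix f assume f: "pfst t = enc f"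
  define x where "x = pfst (psnd t)"
  define y where "y = psnd (psnd t)"
  define xs where "xs = list_decode x"
  have x: "x = list_encode xs" by (simp add: xs_def)
  have S': "ev0 g (list_decode u) v" if "S (trip (enc g) u v)" for g u v
    using S[OF that] by (simp add: sound_def)
  have "ev0 f xs y"
  proof (cases f)
    case Zero
    then have "y = 0" using t f by (simp add: just_def Let_def y_def)
    then show ?thesis using Zero ev_zero by blast
  next
    case Succ
    then have "y = Suc (nthc x 0)" using t f by (simp add: just_def Let_def y_def x_def)
    also have "nthc x 0 = arg0 xs" by (cases xs) (auto simp: xs_def nthc_decode arg0_def)
    finally show ?thesis using Succ ev_succ by blast
  next
    case (Proj i)
    then have "i < length xs \<and> y = xs ! i"
      using t f by (simp add: just_def Let_def y_def x_def xs_def lenc_decode nthc_decode)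
    then show ?thesis using Proj ev_proj by blast
  next
    case (Comp g hs)
    then have "comp_step UNIV S (pair (enc g) (list_encode (map enc hs))) x y"
      using t f by (simp add: just_def Let_def y_def x_def)
    then obtain ys where ys: "S (trip (enc g) (list_encode ys) y)" "length ys = length hs"
      "\<And>k. k < length hs \<Longrightarrow> S (trip (enc (hs ! k)) x (ys ! k))"
      unfolding comp_step_def by (force simp: lenc_encode nthc_encode lenc_decode nthc_decode
          intro: that[of "list_decode ys" for ys])
    show ?thesis
      unfolding Comp using S'[OF ys(1)] S'[OF ys(3)] ys(2)
      by (intro ev_comp[of _ _ _ ys]) (auto simp: list_all2_conv_all_nth xs_def)
  next
    case (PrimRec g h)
    then have *: "primrec_step UNIV S (pair (enc g) (enc h)) x y"
      using t f by (simp add: just_def Let_def y_def x_def)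
    then obtain n us where us: "xs = n # us"
      by (cases xs) (auto simp: primrec_step_def x)
    show ?thesis
    proof (cases n)
      case 0
      then have "S (trip (enc g) (list_encode us) y)"
        using * by (simp add: primrec_step_def x us hdc_encode tlc_encode del: list_encode.simps)
      from S'[OF this] show ?thesis by (simp add: PrimRec us 0 ev_pr0)
    next
      case (Suc m)
      then obtain y' where "S (trip (enc (PrimRec g h)) (list_encode (m # us)) y')"
        "S (trip (enc h) (list_encode (y' # m # us)) y)"
        using * by (auto simp: primrec_step_def x us hdc_encode tlc_encode consc_encode simp del: list_encode.simps)
      from this[THEN S'] show ?thesis
        unfolding PrimRec us Suc by (auto intro: ev_prS simp del: list_encode.simps)
    qed
  next
    case (Minim g)
    then have "minim_step UNIV S (enc g) x y"
      using t f by (simp add: just_def Let_def y_def x_def)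
    then have "S (trip (enc g) (list_encode (y # xs)) 0)"
      "\<forall>m<y. \<exists>v. S (trip (enc g) (list_encode (m # xs)) (Suc v))"
      unfolding minim_step_def x consc_encode by auto
    then show ?thesis
      unfolding Minim using S' by (intro ev_min) (fastforce simp del: list_encode.simps)+
  next
    case Orc
    then have "y = 0" using t f by (simp add: just_def Let_def y_def)
    then show ?thesis using Orc ev_orc[of "\<lambda>_. False" xs] by simp
  qed
  then show "ev0 f (list_decode (pfst (psnd t))) (psnd (psnd t))"
    by (simp add: xs_def x_def y_def)
qed

lemma just_mono:
  assumes "just Q S t" "\<And>s. S s \<Longrightarrow> S' s" shows "just Q S' t"
proof -
  have "comp_step Q S' b x y" if "comp_step Q S b x y" for b x y
    using that assms(2) unfolding comp_step_def by blast
  moreover have "primrec_step Q S' b x y" if "primrec_step Q S b x y" for b x y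
    using that assms(2) unfolding primrec_step_def by blast
  moreover have "minim_step Q S' b x y" if "minim_step Q S b x y" for b x y
    using that assms(2) unfolding minim_step_def by blast
  ultimately show ?thesis using assms(1) unfolding just_def Let_def by blast
qed

lemma trip_ge: "x \<le> trip e x y" "y \<le> trip e x y"
  unfolding trip_def pair_def by (meson le_prod_encode_1 le_prod_encode_2 le_trans)+

text \<open>Every witness sought by the step predicates occurs, as argument list or value and
  possibly under \<open>Suc\<close>, in an assertion satisfying \<open>S\<close>, so it lies below
  any bound on \<open>S\<close>. The search thus becomes bounded and decidable.\<close>

lemma just_bounded:
  assumes "\<And>s. S s \<Longrightarrow> s < B" shows "just {..<B} S t \<longleftrightarrow> just UNIV S t"
proof -
  have le: "x < B" "y < B" "Suc v = y \<Longrightarrow> v < B" if "S (trip e x y)" for e x y v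
    using assms[OF that] trip_ge[where e = e and x = x and y = y] by auto
  have "comp_step {..<B} S b x y \<longleftrightarrow> comp_step UNIV S b x y" for b x y
    unfolding comp_step_def using le by blast
  moreover have "primrec_step {..<B} S b x y \<longleftrightarrow> primrec_step UNIV S b x y" for b x y
    unfolding primrec_step_def using le by blast
  moreover have "minim_step {..<B} S b x y \<longleftrightarrow> minim_step UNIV S b x y" for b x y
    unfolding minim_step_def using le by blast
  ultimately show ?thesis unfolding just_def Let_def by simp
qed

section \<open>Derivations as finite lists of assertions\<close>

definition derivation :: "nat list \<Rightarrow> bool" where
  "derivation L \<longleftrightarrow> (\<forall>i<length L. just UNIV (\<lambda>t. t \<in> set (take i L)) (L ! i))"

lemma derivation_sound: "derivation L \<Longrightarrow> t \<in> set L \<Longrightarrow> sound t"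
proof -
  assume L: "derivation L"
  have "sound (L ! i)" if "i < length L" for i
    using that
  proof (induction i rule: less_induct)
    case (less i)
    show ?case
    proof (rule just_sound)
      show "just UNIV (\<lambda>t. t \<in> set (take i L)) (L ! i)" using L less.prems by (simp add: derivation_def)
      show "sound s" if "s \<in> set (take i L)" for s
        using that less by (auto simp: in_set_conv_nth)
    qed
  qed
  then show "t \<in> set L \<Longrightarrow> sound t" by (auto simp: in_set_conv_nth)
qed

lemma derivation_append:
  assumes "derivation L" "derivation M" shows "derivation (L @ M)"
  unfolding derivation_def
proof (intro allI impI)
  fix i assume i: "i < length (L @ M)"
  show "just UNIV (\<lambda>t. t \<in> set (take i (L @ M))) ((L @ M) ! i)"
  proof (cases "i < length L")
    case True
    then show ?thesis using assms(1) by (auto simp: derivation_def nth_append elim!: just_mono)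
  next
    case False
    then have "just UNIV (\<lambda>t. t \<in> set (take (i - length L) M)) (M ! (i - length L))"
      using assms(2) i by (simp add: derivation_def)
    then show ?thesis using False by (auto simp: nth_append elim!: just_mono)
  qed
qed

definition derivable :: "nat \<Rightarrow> bool" where
  "derivable t \<longleftrightarrow> (\<exists>L. derivation L \<and> t \<in> set L)"

lemma derivable_finite:
  assumes "finite S" "\<And>s. s \<in> S \<Longrightarrow> derivable s"
  shows "\<exists>L. derivation L \<and> S \<subseteq> set L"
  using assms
proof (induction S)
  case empty
  then show ?case by (intro exI[of _ "[]"]) (simp add: derivation_def)
next
  case (insert s S)
  then obtain L M where "derivation L" "S \<subseteq> set L" "derivation M" "s \<in> set M"
    unfolding derivable_def by blast
  then show ?case by (intro exI[of _ "L @ M"]) (auto simp: derivation_append)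
qed

text \<open>Derivations of finitely many premises can be concatenated, and the conclusion is then
  put at the end.\<close>

lemma derivable_just:
  assumes "finite S" "\<And>s. s \<in> S \<Longrightarrow> derivable s" "just UNIV (\<lambda>s. s \<in> S) t"
  shows "derivable t"
proof -
  obtain L where L: "derivation L" "S \<subseteq> set L" using derivable_finite assms(1,2) by blast
  have "just UNIV (\<lambda>s. s \<in> set L) t" using assms(3) by (rule just_mono) (use L(2) in blast)
  then have "derivation (L @ [t])"
    using L(1) by (auto simp: derivation_def nth_append less_Suc_eq)
  then show ?thesis unfolding derivable_def by (intro exI[of _ "L @ [t]"]) auto
qed

lemma ev_derivable: "ev0 f xs y \<Longrightarrow> derivable (trip (enc f) (list_encode xs) y)"
proof (induction rule: ev.induct)
  case (ev_zero xs)
  show ?case by (rule derivable_just[of "{}"]) (auto simp: just_def)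
next
  case (ev_succ xs)
  show ?case
    by (rule derivable_just[of "{}"])
      (auto simp: just_def nthc_encode arg0_def split: list.split simp del: list_encode.simps)
next
  case (ev_proj i xs)
  show ?case by (rule derivable_just[of "{}"]) (use ev_proj in \<open>auto simp: just_def nthc_encode lenc_encode\<close>)
next
  case (ev_comp xs gs ys f z)
  let ?S = "insert (trip (enc f) (list_encode ys) z)
    ((\<lambda>k. trip (enc (gs ! k)) (list_encode xs) (ys ! k)) ` {..<length gs})"
  have len: "length gs = length ys" using ev_comp.IH(1) by (simp add: list_all2_conv_all_nth)
  show ?case
  proof (rule derivable_just[of ?S])
    show "derivable s" if "s \<in> ?S" for s
      using that ev_comp.IH by (auto simp: list_all2_conv_all_nth)
    have "comp_step UNIV (\<lambda>s. s \<in> ?S) (pair (enc f) (list_encode (map enc gs))) (list_encode xs) z"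
      unfolding comp_step_def
      by (rule bexI[of _ "list_encode ys"]) (auto simp: lenc_encode nthc_encode len)
    then show "just UNIV (\<lambda>s. s \<in> ?S) (trip (enc (Comp f gs)) (list_encode xs) z)"
      by (simp add: just_def)
  qed simp
next
  case (ev_pr0 f xs z g)
  show ?case
    by (rule derivable_just[of "{trip (enc f) (list_encode xs) z}"])
      (use ev_pr0 in \<open>auto simp: just_def primrec_step_def hdc_encode tlc_encode list_encode_eq_0 simp del: list_encode.simps\<close>)
next
  case (ev_prS f g n xs y z)
  show ?case
    by (rule derivable_just[of "{trip (enc (PrimRec f g)) (list_encode (n # xs)) y,
          trip (enc g) (list_encode (y # n # xs)) z}"])
      (use ev_prS in \<open>auto simp: just_def Let_def primrec_step_def hdc_encode tlc_encode consc_encode list_encode_eq_0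
        simp del: list_encode.simps\<close>)
next
  case (ev_min f n xs)
  from ev_min.IH(2) obtain v where v: "\<And>m. m < n \<Longrightarrow> derivable (trip (enc f) (list_encode (m # xs)) (Suc (v m)))"
    by metis
  let ?S = "insert (trip (enc f) (list_encode (n # xs)) 0)
    ((\<lambda>m. trip (enc f) (list_encode (m # xs)) (Suc (v m))) ` {..<n})"
  show ?case
  proof (rule derivable_just[of ?S])
    show "derivable s" if "s \<in> ?S" for s
      using that ev_min.IH(1) v by (auto simp del: list_encode.simps)
    have "minim_step UNIV (\<lambda>s. s \<in> ?S) (enc f) (list_encode xs) n"
      unfolding minim_step_def consc_encode by auto
    then show "just UNIV (\<lambda>s. s \<in> ?S) (trip (enc (Minim f)) (list_encode xs) n)"
      by (simp add: just_def)
  qed simp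
next
  case (ev_orc xs)
  show ?case by (rule derivable_just[of "{}"]) (auto simp: just_def)
qed

definition earlier :: "nat \<Rightarrow> nat \<Rightarrow> nat \<Rightarrow> bool" where
  "earlier d i t \<longleftrightarrow> (\<exists>j<i. nthc d j = t)"

lemma rec1_trip [rec_intros]:
  "rec1 e \<Longrightarrow> rec1 x \<Longrightarrow> rec1 y \<Longrightarrow> rec1 (\<lambda>z. trip (e z) (x z) (y z))"
  unfolding trip_def by (intro rec_intros)

lemma decp_earlier [rec_intros]:
  assumes "rec1 d" "rec1 i" "rec1 t" shows "decp (\<lambda>z. earlier (d z) (i z) (t z))"
proof -
  have "decp (\<lambda>z. earlier (pfst z) (pfst (psnd z)) (psnd (psnd z)))"
    unfolding earlier_def by (intro rec_intros)
  moreover have "rec1 (\<lambda>z. pair (d z) (pair (i z) (t z)))" by (intro rec_intros assms)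
  ultimately show ?thesis by (rule decp_comp[elim_format]) simp
qed

text \<open>Kleene's predicate: \<open>d\<close> codes a derivation containing an assertion about
  program \<open>e\<close> on input \<open>n\<close>, with any value. \<open>consc n 0\<close> is
  the code of \<open>[n]\<close>; the bound \<open>{..<d}\<close> suffices since the entries of a
  list are below its code.\<close>

definition kleeneT :: "nat \<Rightarrow> nat \<Rightarrow> nat \<Rightarrow> bool" where
  "kleeneT e n d \<longleftrightarrow> (\<forall>i<lenc d. just {..<d} (earlier d i) (nthc d i)) \<and>
     (\<exists>i<lenc d. pfst (nthc d i) = e \<and> pfst (psnd (nthc d i)) = consc n 0)"

lemma mem_less_list_encode: "x \<in> set xs \<Longrightarrow> x < list_encode xs"
proof (induction xs)
  case (Cons a xs)
  then show ?case
    using le_prod_encode_1[of a "list_encode xs"] le_prod_encode_2[of "list_encode xs" a] by auto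
qed simp

lemma kleeneT_iff:
  "kleeneT e n (list_encode L) \<longleftrightarrow> derivation L \<and> (\<exists>y. trip e (list_encode [n]) y \<in> set L)"
proof -
  have "just {..<list_encode L} (earlier (list_encode L) i) (nthc (list_encode L) i) \<longleftrightarrow>
      just UNIV (\<lambda>t. t \<in> set (take i L)) (L ! i)" if "i < length L" for i
  proof -
    have "earlier (list_encode L) i = (\<lambda>t. t \<in> set (take i L))"
      using that nth_image[of i L, symmetric] by (fastforce simp: nthc_encode earlier_def fun_eq_iff)
    then show ?thesis
      using that by (simp add: nthc_encode just_bounded mem_less_list_encode[OF in_set_takeD])
  qed
  moreover have "pfst t = e \<and> pfst (psnd t) = consc n 0 \<longleftrightarrow> (\<exists>y. t = trip e (list_encode [n]) y)" for t
    using consc_encode[of n "[]"] by (metis list_encode.simps(1) trip_simps)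
  then have "(\<exists>i<length L. pfst (L ! i) = e \<and> pfst (psnd (L ! i)) = consc n 0) \<longleftrightarrow>
      (\<exists>y. trip e (list_encode [n]) y \<in> set L)"
    by (metis in_set_conv_nth)
  ultimately show ?thesis by (simp add: kleeneT_def derivation_def lenc_encode nthc_encode cong: conj_cong)
qed

text \<open>Completeness of derivations gives one direction, their soundness the other. Halting
  thereby becomes the existence of a number with a decidable property.\<close>

theorem kleeneT: "(\<exists>y. ev0 f [n] y) \<longleftrightarrow> (\<exists>d. kleeneT (enc f) n d)"
proof
  assume "\<exists>y. ev0 f [n] y"
  then obtain y L where "derivation L" "trip (enc f) (list_encode [n]) y \<in> set L"
    using ev_derivable unfolding derivable_def by blast
  then show "\<exists>d. kleeneT (enc f) n d" using kleeneT_iff by blast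
next
  assume "\<exists>d. kleeneT (enc f) n d"
  then obtain L where "kleeneT (enc f) n (list_encode L)" by (metis list_decode_inverse)
  then obtain y where "sound (trip (enc f) (list_encode [n]) y)"
    unfolding kleeneT_iff using derivation_sound by blast
  then show "\<exists>y. ev0 f [n] y" by (auto simp: sound_def simp del: list_encode.simps)
qed

lemma decp_comp_step [rec_intros]:
  assumes "rec1 d" "rec1 i" "rec1 b" "rec1 x" "rec1 y"
  shows "decp (\<lambda>z. comp_step {..<d z} (earlier (d z) (i z)) (b z) (x z) (y z))"
proof -
  have "decp (\<lambda>z. comp_step {..<pfst z} (earlier (pfst z) (pfst (psnd z))) (pfst (psnd (psnd z)))
      (pfst (psnd (psnd (psnd z)))) (psnd (psnd (psnd (psnd z)))))"
    unfolding comp_step_def Bex_def lessThan_iff by (intro rec_intros)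
  moreover have "rec1 (\<lambda>z. pair (d z) (pair (i z) (pair (b z) (pair (x z) (y z)))))"
    by (intro rec_intros assms)
  ultimately show ?thesis by (rule decp_comp[elim_format]) simp
qed

lemma decp_primrec_step [rec_intros]:
  assumes "rec1 d" "rec1 i" "rec1 b" "rec1 x" "rec1 y"
  shows "decp (\<lambda>z. primrec_step {..<d z} (earlier (d z) (i z)) (b z) (x z) (y z))"
proof -
  have "decp (\<lambda>z. primrec_step {..<pfst z} (earlier (pfst z) (pfst (psnd z))) (pfst (psnd (psnd z)))
      (pfst (psnd (psnd (psnd z)))) (psnd (psnd (psnd (psnd z)))))"
    unfolding primrec_step_def Bex_def lessThan_iff by (intro rec_intros)
  moreover have "rec1 (\<lambda>z. pair (d z) (pair (i z) (pair (b z) (pair (x z) (y z)))))"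
    by (intro rec_intros assms)
  ultimately show ?thesis by (rule decp_comp[elim_format]) simp
qed

lemma decp_minim_step [rec_intros]:
  assumes "rec1 d" "rec1 i" "rec1 b" "rec1 x" "rec1 y"
  shows "decp (\<lambda>z. minim_step {..<d z} (earlier (d z) (i z)) (b z) (x z) (y z))"
proof -
  have "decp (\<lambda>z. minim_step {..<pfst z} (earlier (pfst z) (pfst (psnd z))) (pfst (psnd (psnd z)))
      (pfst (psnd (psnd (psnd z)))) (psnd (psnd (psnd (psnd z)))))"
    unfolding minim_step_def Bex_def lessThan_iff by (intro rec_intros)
  moreover have "rec1 (\<lambda>z. pair (d z) (pair (i z) (pair (b z) (pair (x z) (y z)))))"
    by (intro rec_intros assms)
  ultimately show ?thesis by (rule decp_comp[elim_format]) simp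
qed

lemma decp_kleeneT [rec_intros]:
  assumes "rec1 e" "rec1 n" "rec1 d" shows "decp (\<lambda>x. kleeneT (e x) (n x) (d x))"
proof -
  have "decp (\<lambda>z. kleeneT (pfst z) (pfst (psnd z)) (psnd (psnd z)))"
    unfolding kleeneT_def just_def Let_def by (intro rec_intros)
  moreover have "rec1 (\<lambda>x. pair (e x) (pair (n x) (d x)))" by (intro rec_intros assms)
  ultimately show ?thesis by (rule decp_comp[elim_format]) simp
qed

section \<open>Computably enumerable predicates and effectively open sets\<close>

definition sigma1 :: "(nat \<Rightarrow> bool) \<Rightarrow> bool" where
  "sigma1 P \<longleftrightarrow> (\<exists>D. decp (\<lambda>z. D (pfst z) (psnd z)) \<and> (\<forall>x. P x \<longleftrightarrow> (\<exists>d. D d x)))"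

lemma sigma1I: "decp (\<lambda>z. D (pfst z) (psnd z)) \<Longrightarrow> (\<And>x. P x \<longleftrightarrow> (\<exists>d. D d x)) \<Longrightarrow> sigma1 P"
  unfolding sigma1_def by blast

lemma sigma1E:
  assumes "sigma1 P"
  obtains D where "decp (\<lambda>z. D (pfst z) (psnd z))" "\<forall>x. P x \<longleftrightarrow> (\<exists>d. D d x)"
  using assms unfolding sigma1_def by blast

lemma sigma1_decp: "decp P \<Longrightarrow> sigma1 P"
  by (rule sigma1I[of "\<lambda>_. P"]) (simp_all add: decp_comp rec1_psnd)

lemma sigma1_comp: "sigma1 P \<Longrightarrow> rec1 f \<Longrightarrow> sigma1 (\<lambda>x. P (f x))"
proof (erule sigma1E)
  fix D assume D: "decp (\<lambda>z. D (pfst z) (psnd z))" "\<forall>x. P x \<longleftrightarrow> (\<exists>d. D d x)" and f: "rec1 f"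
  have "decp (\<lambda>z. D (pfst z) (f (psnd z)))"
    by (rule decp_comp2[where P = D, OF D(1)]) (intro rec_intros rec1_comp[OF f])+
  then show "sigma1 (\<lambda>x. P (f x))" by (rule sigma1I) (simp add: D(2))
qed

lemma sigma1_conj: "sigma1 P \<Longrightarrow> sigma1 Q \<Longrightarrow> sigma1 (\<lambda>x. P x \<and> Q x)"
proof (elim sigma1E)
  fix D E assume D: "decp (\<lambda>z. D (pfst z) (psnd z))" "\<forall>x. P x \<longleftrightarrow> (\<exists>d. D d x)"
    and E: "decp (\<lambda>z. E (pfst z) (psnd z))" "\<forall>x. Q x \<longleftrightarrow> (\<exists>d. E d x)"
  have "decp (\<lambda>z. D (pfst (pfst z)) (psnd z) \<and> E (psnd (pfst z)) (psnd z))"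
    by (intro decp_conj decp_comp2[where P = D, OF D(1)] decp_comp2[where P = E, OF E(1)] rec_intros)
  then show "sigma1 (\<lambda>x. P x \<and> Q x)"
    by (rule sigma1I) (metis D(2) E(2) pair_simps(1,2))
qed

lemma sigma1_ex: "sigma1 (\<lambda>z. P (pfst z) (psnd z)) \<Longrightarrow> sigma1 (\<lambda>x. \<exists>m. P m x)"
proof (erule sigma1E)
  fix D assume D: "decp (\<lambda>z. D (pfst z) (psnd z))" "\<forall>z. P (pfst z) (psnd z) \<longleftrightarrow> (\<exists>d. D d z)"
  have "decp (\<lambda>z. D (pfst (pfst z)) (pair (psnd (pfst z)) (psnd z)))"
    by (intro decp_comp2[where P = D, OF D(1)] rec_intros)
  then show "sigma1 (\<lambda>x. \<exists>m. P m x)"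
    by (rule sigma1I) (metis D(2) pair_simps(1,2))
qed

text \<open>A domain is a projection by Kleene's predicate; conversely, the program searching for
  the least witness halts exactly on the projection.\<close>

lemma ce_iff_sigma1: "ce S \<longleftrightarrow> sigma1 (\<lambda>n. n \<in> S)"
proof
  assume "ce S"
  then obtain f where f: "\<And>n. n \<in> S \<longleftrightarrow> (\<exists>d. kleeneT (enc f) n d)"
    unfolding ce_def kleeneT by blast
  show "sigma1 (\<lambda>n. n \<in> S)"
    by (rule sigma1I[of "\<lambda>d n. kleeneT (enc f) n d", OF _ f]) (intro rec_intros)
next
  assume "sigma1 (\<lambda>n. n \<in> S)"
  then obtain D where D: "decp (\<lambda>z. D (pfst z) (psnd z))" "\<And>n. n \<in> S \<longleftrightarrow> (\<exists>d. D d n)"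
    by (auto elim: sigma1E)
  let ?g = "\<lambda>d n. if D d n then 0 else 1 :: nat"
  have "rec2 ?g" by (intro rec1_rec2 rec_intros D(1))
  then obtain r where r: "\<And>d n. ev0 r [d, n] (?g d n)" unfolding rec2_def by blast
  have "n \<in> S \<longleftrightarrow> (\<exists>y. ev0 (Minim r) [n] y)" for n
  proof
    assume "n \<in> S"
    then have "D (LEAST d. D d n) n" using D(2) LeastI_ex[of "\<lambda>d. D d n"] by blast
    then have "ev0 (Minim r) [n] (LEAST d. D d n)"
      using r[of _ n] not_less_Least[of _ "\<lambda>d. D d n"] by (intro ev_min) (metis, metis One_nat_def)
    then show "\<exists>y. ev0 (Minim r) [n] y" ..
  next
    assume "\<exists>y. ev0 (Minim r) [n] y"
    then obtain y where "ev0 r [y, n] 0" by (auto elim: ev_MinimE)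
    then have "?g y n = 0" by (rule ev_deterministic[OF r])
    then show "n \<in> S" using D(2) by (auto split: if_splits)
  qed
  then show "ce S" unfolding ce_def by blast
qed

lemma unif_eff_open_iff:
  "unif_eff_open U \<longleftrightarrow> (\<forall>i. cantor_open (U i)) \<and>
    sigma1 (\<lambda>n. \<exists>\<sigma>. psnd n = code_str \<sigma> \<and> cyl \<sigma> \<subseteq> U (pfst n))"
proof -
  have "n \<in> {prod_encode (i, code_str \<sigma>) |i \<sigma>. cyl \<sigma> \<subseteq> U i} \<longleftrightarrow>
      (\<exists>\<sigma>. psnd n = code_str \<sigma> \<and> cyl \<sigma> \<subseteq> U (pfst n))" for n
    unfolding pair_def[symmetric] by (auto, metis pair_simps(3))
  then show ?thesis unfolding unif_eff_open_def ce_iff_sigma1 by presburger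
qed

lemma unif_eff_open_reindex:
  assumes U: "unif_eff_open U" and h: "rec1 h" shows "unif_eff_open (\<lambda>i. U (h i))"
proof -
  have "sigma1 (\<lambda>n. \<exists>\<sigma>. psnd n = code_str \<sigma> \<and> cyl \<sigma> \<subseteq> U (pfst n))"
    using U by (simp add: unif_eff_open_iff)
  moreover have "rec1 (\<lambda>n. pair (h (pfst n)) (psnd n))" by (intro rec_intros rec1_comp[OF h])
  ultimately have "sigma1 (\<lambda>n. \<exists>\<sigma>. psnd n = code_str \<sigma> \<and> cyl \<sigma> \<subseteq> U (h (pfst n)))"
    by (rule sigma1_comp[elim_format]) simp
  then show ?thesis using U by (simp add: unif_eff_open_iff)
qed

section \<open>Codes of strings, compactness and effective unions of cylinders\<close>

lemma code_str_simps [simp]: "lenc (code_str \<sigma>) = length \<sigma>"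
  "k < length \<sigma> \<Longrightarrow> nthc (code_str \<sigma>) k = of_bool (\<sigma> ! k)"
  by (simp_all add: code_str_def lenc_encode nthc_encode)

lemma code_str_iff: "(\<exists>\<sigma>. c = code_str \<sigma>) \<longleftrightarrow> (\<forall>k<lenc c. nthc c k \<le> 1)"
proof
  assume c: "\<forall>k<lenc c. nthc c k \<le> 1"
  have "list_decode c = map (\<lambda>b. if b then 1 else 0) (map (\<lambda>x. x = 1) (list_decode c))"
    by (rule nth_equalityI) (use c in \<open>auto simp: lenc_decode nthc_decode le_Suc_eq\<close>)
  then show "\<exists>\<sigma>. c = code_str \<sigma>"
    unfolding code_str_def by (metis list_decode_inverse)
qed auto

lemma inj_code_str: "inj code_str"
proof (rule injI)
  fix \<sigma> \<tau> assume eq: "code_str \<sigma> = code_str \<tau>"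
  then have "length \<sigma> = length \<tau>" by (metis code_str_simps(1))
  moreover have "\<sigma> ! k = \<tau> ! k" if "k < length \<sigma>" "k < length \<tau>" for k
    using that code_str_simps(2)[of k \<sigma>] code_str_simps(2)[of k \<tau>] eq by (auto simp: of_bool_eq_iff)
  ultimately show "\<sigma> = \<tau>" by (auto intro: nth_equalityI)
qed

lemma length_le_code_str: "length \<sigma> \<le> code_str \<sigma>"
proof -
  have "length xs \<le> list_encode xs" for xs
  proof (induction xs)
    case (Cons x xs)
    then show ?case using le_prod_encode_2[of "list_encode xs" x] by auto
  qed simp
  from this[of "map (\<lambda>b. if b then 1 else 0) \<sigma>"] show ?thesis by (simp add: code_str_def)
qed

lemma cyl_map: "cyl (map P [0..<n]) = {X. \<forall>k<n. X k = P k}"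
  by (auto simp: cyl_def)

lemma cyl_prefix: "X \<in> cyl \<sigma> \<Longrightarrow> map X [0..<length \<sigma>] = \<sigma>"
  by (auto simp: cyl_def intro: nth_equalityI)

lemma cyl_append1: "cyl \<sigma> = cyl (\<sigma> @ [False]) \<union> cyl (\<sigma> @ [True])"
  by (auto simp: cyl_def nth_append less_Suc_eq)

lemma cantor_open_UN_cyl: "cantor_open (\<Union>\<sigma>\<in>S. cyl \<sigma>)"
  unfolding cantor_open_def by blast

lemma cantor_openE:
  assumes "cantor_open U" "X \<in> U"
  obtains n where "cyl (map X [0..<n]) \<subseteq> U"
  using assms cyl_prefix unfolding cantor_open_def by metis

text \<open>The path takes the left child whenever that child satisfies \<open>Q\<close>. It serves
  as Koenig's lemma in the compactness proof and later yields the leftmost point outside a component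
  of the test.\<close>

lemma leftmost_path:
  assumes "Q []" and step: "\<And>\<rho>. Q \<rho> \<Longrightarrow> Q (\<rho> @ [False]) \<or> Q (\<rho> @ [True])"
  shows "\<exists>P. (\<forall>n. Q (map P [0..<n])) \<and> (\<forall>n. P n \<longrightarrow> \<not> Q (map P [0..<n] @ [False]))"
proof -
  define p where "p = rec_nat [] (\<lambda>_ \<rho>. if Q (\<rho> @ [False]) then \<rho> @ [False] else \<rho> @ [True])"
  define P where "P n \<longleftrightarrow> \<not> Q (p n @ [False])" for n
  have p: "map P [0..<n] = p n" for n
    by (induction n) (auto simp: p_def P_def)
  have "Q (p n)" for n
    by (induction n) (use assms in \<open>auto simp: p_def\<close>)
  then show ?thesis by (intro exI[of _ P]) (auto simp: p P_def)
qed

text \<open>If no \<open>A n\<close> contains the cylinder, then the same is true of one of its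
  halves, because \<open>A\<close> is increasing. Iteration leads to a point all of whose
  neighbourhoods escape every \<open>A n\<close>, against openness.\<close>

lemma cyl_compact:
  assumes op: "\<And>n. cantor_open (A n)" and inc: "incseq A" and cover: "cyl \<sigma> \<subseteq> (\<Union>n. A n)"
  shows "\<exists>n. cyl \<sigma> \<subseteq> A n"
proof (rule ccontr)
  assume no: "\<not> (\<exists>n. cyl \<sigma> \<subseteq> A n)"
  define Q where "Q \<rho> \<longleftrightarrow> (\<forall>n. \<not> cyl \<rho> \<inter> cyl \<sigma> \<subseteq> A n)" for \<rho>
  have "Q []" using no by (auto simp: Q_def cyl_def)
  moreover have "Q (\<rho> @ [False]) \<or> Q (\<rho> @ [True])" if "Q \<rho>" for \<rho>
  proof (rule ccontr)
    assume "\<not> ?thesis"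
    then obtain n m where "cyl (\<rho> @ [False]) \<inter> cyl \<sigma> \<subseteq> A n" "cyl (\<rho> @ [True]) \<inter> cyl \<sigma> \<subseteq> A m"
      by (auto simp: Q_def)
    moreover have "A n \<subseteq> A (max n m)" "A m \<subseteq> A (max n m)" using inc by (auto simp: incseq_def)
    ultimately have "cyl \<rho> \<inter> cyl \<sigma> \<subseteq> A (max n m)" using cyl_append1[of \<rho>] by blast
    then show False using that by (auto simp: Q_def)
  qed
  ultimately obtain P where P: "\<forall>n. Q (map P [0..<n])" using leftmost_path[of Q] by blast
  \<comment> \<open>The intersection is nonempty because the empty set lies in every
    \<open>A n\<close>; at this length that forces \<open>P\<close> to extend \<sigma>.\<close>
  obtain Y where "Y \<in> cyl (map P [0..<length \<sigma>])" "Y \<in> cyl \<sigma>"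
    using P[rule_format, of "length \<sigma>"] unfolding Q_def by blast
  then have "P \<in> cyl \<sigma>" by (auto simp: cyl_def)
  then obtain n where "P \<in> A n" using cover by blast
  with op obtain m where "cyl (map P [0..<m]) \<subseteq> A n" by (rule cantor_openE)
  then show False using P[rule_format, of m] unfolding Q_def by blast
qed

text \<open>The number \<open>w\<close> is read as the sequence \<open>bit w\<close>, least
  significant bit first; the condition says that \<open>c\<close> codes one of its prefixes.\<close>

definition agrees :: "nat \<Rightarrow> nat \<Rightarrow> bool" where
  "agrees c w \<longleftrightarrow> (\<forall>k<lenc c. nthc c k = of_bool (bit w k))"

lemma decp_agrees [rec_intros]:
  assumes "rec1 f" "rec1 g" shows "decp (\<lambda>x. agrees (f x) (g x))"
proof -
  have "decp (\<lambda>z. agrees (pfst z) (psnd z))"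
    unfolding agrees_def of_bool_def by (intro rec_intros)
  then show ?thesis using assms by (rule decp_comp2[where P = agrees])
qed

lemma agrees_code_str: "agrees (code_str \<sigma>) w \<longleftrightarrow> bit w \<in> cyl \<sigma>"
  by (auto simp: agrees_def cyl_def)

lemma agrees_imp_code_str: "agrees c w \<Longrightarrow> \<exists>\<sigma>. c = code_str \<sigma>"
  unfolding code_str_iff by (simp add: agrees_def)

lemma ex_word: "\<exists>w<2 ^ n. \<forall>k<n. bit (w::nat) k = X k"
proof -
  let ?w = "horner_sum of_bool 2 (map X [0..<n]) :: nat"
  have "?w < 2 ^ n" using horner_sum_of_bool_2_less[of "map X [0..<n]"] by simp
  moreover have "\<forall>k<n. bit ?w k = X k" by (simp add: bit_horner_sum_bit_iff)
  ultimately show ?thesis by blast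
qed

lemma word_eqI:
  fixes w :: nat
  assumes "w < 2 ^ n" "v < 2 ^ n" "\<And>k. k < n \<Longrightarrow> bit w k = bit v k" shows "w = v"
proof -
  have "take_bit n w = take_bit n v" by (rule bit_eqI) (auto simp: bit_take_bit_iff assms(3))
  then show ?thesis using assms by (simp add: take_bit_nat_eq_self)
qed

lemma cyl_cong: "X \<in> cyl \<sigma> \<Longrightarrow> (\<And>k. k < length \<sigma> \<Longrightarrow> X k = Y k) \<Longrightarrow> Y \<in> cyl \<sigma>"
  by (auto simp: cyl_def)

text \<open>Enumerating generators is enough: by compactness a cylinder inside the union is already
  covered by the finitely many generators found by some stage \<open>t\<close>, and covering by
  finitely many cylinders is decidable.\<close>

lemma unif_eff_open_sigma1:
  assumes E: "sigma1 (\<lambda>z. E (pfst z) (psnd z))"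
  shows "unif_eff_open (\<lambda>i. \<Union>\<sigma>\<in>{\<sigma>. E i (code_str \<sigma>)}. cyl \<sigma>)" (is "unif_eff_open ?U")
proof -
  obtain D where D: "decp (\<lambda>z. D (pfst z) (psnd z))"
    and ED: "\<And>z. E (pfst z) (psnd z) \<longleftrightarrow> (\<exists>d. D d z)"
    using E by (auto elim: sigma1E)
  have ED: "E i c \<longleftrightarrow> (\<exists>d. D d (pair i c))" for i c using ED[of "pair i c"] by simp
  define C where "C i t = {\<sigma>. code_str \<sigma> < t \<and> (\<exists>d<t. D d (pair i (code_str \<sigma>)))}" for i t
  \<comment> \<open>Codes bound lengths, so \<open>t + c\<close> bits decide membership in the
    cylinder coded by \<open>c\<close> and in those with code below \<open>t\<close>.\<close>
  define R where "R i c t \<longleftrightarrow> (\<forall>w<2 ^ (t + c). agrees c w \<longrightarrow>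
    (\<exists>c'<t. (\<exists>d<t. D d (pair i c')) \<and> agrees c' w))" for i c t
  have U: "?U i = (\<Union>t. \<Union>\<sigma>\<in>C i t. cyl \<sigma>)" for i
  proof -
    have "(\<exists>t. \<sigma> \<in> C i t) \<longleftrightarrow> E i (code_str \<sigma>)" for \<sigma>
    proof
      assume "E i (code_str \<sigma>)"
      then obtain d where "D d (pair i (code_str \<sigma>))" unfolding ED ..
      then have "\<sigma> \<in> C i (Suc (max d (code_str \<sigma>)))"
        unfolding C_def by (auto intro!: exI[of _ d])
      then show "\<exists>t. \<sigma> \<in> C i t" ..
    qed (auto simp: C_def ED)
    then have "{\<sigma>. E i (code_str \<sigma>)} = (\<Union>t. C i t)" by blast
    then show ?thesis by (simp only: UN_UN_flatten)
  qed
  have inc: "incseq (\<lambda>t. \<Union>\<sigma>\<in>C i t. cyl \<sigma>)" for i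
    by (rule incseq_SucI) (auto simp: C_def less_Suc_eq)
  have R: "cyl \<sigma> \<subseteq> (\<Union>\<tau>\<in>C i t. cyl \<tau>) \<longleftrightarrow> R i (code_str \<sigma>) t" for i \<sigma> t
  proof
    assume sub: "cyl \<sigma> \<subseteq> (\<Union>\<tau>\<in>C i t. cyl \<tau>)"
    show "R i (code_str \<sigma>) t"
      unfolding R_def
    proof (intro allI impI)
      fix w assume "agrees (code_str \<sigma>) w"
      then obtain \<tau> where "\<tau> \<in> C i t" "agrees (code_str \<tau>) w"
        using sub by (auto simp: agrees_code_str)
      then show "\<exists>c'<t. (\<exists>d<t. D d (pair i c')) \<and> agrees c' w"
        by (intro exI[of _ "code_str \<tau>"]) (simp add: C_def)
    qed
  next
    assume R: "R i (code_str \<sigma>) t"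
    show "cyl \<sigma> \<subseteq> (\<Union>\<tau>\<in>C i t. cyl \<tau>)"
    proof
      fix X assume X: "X \<in> cyl \<sigma>"
      obtain w :: nat where w: "w < 2 ^ (t + code_str \<sigma>)" "\<And>k. k < t + code_str \<sigma> \<Longrightarrow> bit w k = X k"
        using ex_word[of "t + code_str \<sigma>" X] by auto
      have "agrees (code_str \<sigma>) w"
        unfolding agrees_code_str using X
        by (rule cyl_cong) (use w(2) length_le_code_str[of \<sigma>] in auto)
      then obtain \<tau> where \<tau>: "code_str \<tau> < t" "\<exists>d<t. D d (pair i (code_str \<tau>))" "bit w \<in> cyl \<tau>"
        using R w(1) agrees_imp_code_str unfolding R_def agrees_code_str[symmetric] by blast
      have "X \<in> cyl \<tau>"
        using \<tau>(3) by (rule cyl_cong) (use w(2) length_le_code_str[of \<tau>] \<tau>(1) in auto)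
      then show "X \<in> (\<Union>\<tau>\<in>C i t. cyl \<tau>)" using \<tau> by (auto simp: C_def)
    qed
  qed
  have "cyl \<sigma> \<subseteq> ?U i \<longleftrightarrow> (\<exists>t. R i (code_str \<sigma>) t)" for i \<sigma>
    unfolding R[symmetric] U using cyl_compact[OF cantor_open_UN_cyl inc, of \<sigma>] by blast
  then have eq: "(\<exists>\<sigma>. psnd n = code_str \<sigma> \<and> cyl \<sigma> \<subseteq> ?U (pfst n)) \<longleftrightarrow>
      (\<forall>k<lenc (psnd n). nthc (psnd n) k \<le> 1) \<and> (\<exists>t. R (pfst n) (psnd n) t)" for n
    unfolding code_str_iff[symmetric] by metis
  have "sigma1 (\<lambda>n. (\<forall>k<lenc (psnd n). nthc (psnd n) k \<le> 1) \<and> (\<exists>t. R (pfst n) (psnd n) t))"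
    unfolding R_def by (intro sigma1_conj sigma1_ex sigma1_decp rec_intros decp_comp2[where P = D, OF D])
  then show ?thesis
    unfolding unif_eff_open_iff eq by (simp add: cantor_open_UN_cyl)
qed

section \<open>Measure\<close>

interpretation bits: product_prob_space "\<lambda>_::nat. measure_pmf (pmf_of_set (UNIV :: bool set))" UNIV
  by unfold_locales

lemma space_lam [simp]: "space lam = UNIV"
  by (auto simp: lam_def space_PiM)

lemma prob_space_lam: "prob_space lam"
  unfolding lam_def by (rule bits.prob_space_axioms)

lemma cyl_eq_emb: "cyl \<sigma> = prod_emb UNIV (\<lambda>_::nat. measure_pmf (pmf_of_set (UNIV :: bool set)))
    {..<length \<sigma>} (Pi\<^sub>E {..<length \<sigma>} (\<lambda>k. {\<sigma> ! k}))"
  by (auto simp: cyl_def prod_emb_def PiE_iff restrict_def extensional_def)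

lemma sets_cyl [measurable]: "cyl \<sigma> \<in> sets lam"
  unfolding cyl_eq_emb lam_def by (intro sets_PiM_I) auto

lemma emeasure_cyl: "emeasure lam (cyl \<sigma>) = ennreal ((1/2) ^ length \<sigma>)"
proof -
  have "emeasure (measure_pmf (pmf_of_set (UNIV :: bool set))) {b} = ennreal (1/2)" for b
    by (simp add: emeasure_pmf_single)
  then show ?thesis
    unfolding cyl_eq_emb lam_def
    by (subst bits.emeasure_PiM_emb) (auto simp: ennreal_power[symmetric])
qed

lemma sets_cantor_open: "cantor_open U \<Longrightarrow> U \<in> sets lam"
proof -
  assume "cantor_open U"
  then have "U = (\<Union>\<sigma>\<in>{\<sigma>. cyl \<sigma> \<subseteq> U}. cyl \<sigma>)" unfolding cantor_open_def by blast
  also have "\<dots> \<in> sets lam" by (rule sets.countable_UN') auto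
  finally show ?thesis .
qed

definition block :: "nat \<Rightarrow> nat \<Rightarrow> cantor set" where
  "block n w = cyl (map (bit w) [0..<n])"

lemma emeasure_blocks:
  assumes "W \<subseteq> {..<2 ^ n}"
  shows "emeasure lam (\<Union>w\<in>W. block n w) = ennreal (card W * (1/2) ^ n)"
proof -
  have fin: "finite W" using assms finite_subset by blast
  have "disjoint_family_on (block n) W"
    unfolding disjoint_family_on_def
  proof (intro ballI impI)
    fix w v assume "w \<in> W" "v \<in> W" "w \<noteq> v"
    then obtain k where "k < n" "bit w k \<noteq> bit v k" using word_eqI assms by blast
    then show "block n w \<inter> block n v = {}" by (auto simp: block_def cyl_map)
  qed
  then have "emeasure lam (\<Union>w\<in>W. block n w) = (\<Sum>w\<in>W. emeasure lam (block n w))"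
    using fin sets_cyl by (intro sum_emeasure[symmetric]) (auto simp: block_def[abs_def])
  also have "\<dots> = (\<Sum>w\<in>W. ennreal ((1/2) ^ n))" by (simp add: block_def emeasure_cyl)
  also have "\<dots> = ennreal (\<Sum>w\<in>W. (1/2) ^ n)" by (rule sum_ennreal) simp
  finally show ?thesis by simp
qed

section \<open>A universal Martin-Loef test\<close>

text \<open>The number \<open>e\<close> is read as the code of a program accepting pairs of a
  component index and a string code. The bound \<open>t\<close> limits both the halting witness and
  the string code, so each stage is a finite union.\<close>

definition hit :: "nat \<Rightarrow> nat \<Rightarrow> nat \<Rightarrow> nat \<Rightarrow> bool" where
  "hit e j t c \<longleftrightarrow> c < t \<and> (\<exists>d<t. kleeneT e (pair j c) d)"

definition stage :: "nat \<Rightarrow> nat \<Rightarrow> nat \<Rightarrow> cantor set" where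
  "stage e j t = (\<Union>\<sigma>\<in>{\<sigma>. hit e j t (code_str \<sigma>)}. cyl \<sigma>)"

definition covered :: "nat \<Rightarrow> nat \<Rightarrow> nat \<Rightarrow> nat \<Rightarrow> bool" where
  "covered e j t w \<longleftrightarrow> (\<exists>c<t. hit e j t c \<and> agrees c w)"

text \<open>The \<open>e\<close>-th candidate test is cut off at the first stage where its \<open>j\<close>-th component gets too large.
  Strings enumerated before stage \<open>t\<close> are shorter than \<open>t\<close>, so the measure of the stage is
  found by counting words of length \<open>t\<close>, read as numbers below \<open>2 ^ t\<close>.\<close>

definition small :: "nat \<Rightarrow> nat \<Rightarrow> nat \<Rightarrow> bool" where
  "small e j t \<longleftrightarrow> card {w. w < 2 ^ t \<and> covered e j t w} * 2 ^ j \<le> 2 ^ t"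

lemma incseq_stage: "incseq (stage e j)"
  by (rule incseq_SucI) (fastforce simp: stage_def hit_def less_Suc_eq)

lemma sets_stage [measurable]: "stage e j t \<in> sets lam"
  unfolding stage_def by (intro sets_cantor_open cantor_open_UN_cyl)

lemma stage_eq_blocks: "stage e j t = (\<Union>w\<in>{w. w < 2 ^ t \<and> covered e j t w}. block t w)"
proof (intro set_eqI iffI)
  fix X assume "X \<in> stage e j t"
  then obtain \<sigma> where \<sigma>: "hit e j t (code_str \<sigma>)" "X \<in> cyl \<sigma>" by (auto simp: stage_def)
  then have lt: "code_str \<sigma> < t" by (simp add: hit_def)
  obtain w :: nat where w: "w < 2 ^ t" "\<forall>k<t. bit w k = X k" using ex_word by blast
  have "bit w \<in> cyl \<sigma>"
    using \<sigma>(2) by (rule cyl_cong) (use w(2) length_le_code_str[of \<sigma>] lt in auto)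
  then have "covered e j t w"
    using \<sigma>(1) lt by (auto simp: covered_def agrees_code_str[symmetric])
  moreover have "X \<in> block t w" using w(2) by (simp add: block_def cyl_map)
  ultimately show "X \<in> (\<Union>w\<in>{w. w < 2 ^ t \<and> covered e j t w}. block t w)" using w(1) by blast
next
  fix X assume "X \<in> (\<Union>w\<in>{w. w < 2 ^ t \<and> covered e j t w}. block t w)"
  then obtain w c where w: "X \<in> block t w" "hit e j t c" "agrees c w" by (auto simp: covered_def)
  then obtain \<sigma> where \<sigma>: "c = code_str \<sigma>" "bit w \<in> cyl \<sigma>"
    using agrees_imp_code_str agrees_code_str by blast
  have "X \<in> cyl \<sigma>"
    using \<sigma>(2) by (rule cyl_cong)
      (use w(1,2) \<sigma>(1) length_le_code_str[of \<sigma>] in \<open>auto simp: block_def cyl_map hit_def\<close>)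
  then show "X \<in> stage e j t" using w(2) \<sigma>(1) by (auto simp: stage_def)
qed

lemma small_iff: "small e j t \<longleftrightarrow> emeasure lam (stage e j t) \<le> ennreal ((1/2) ^ j)"
proof -
  let ?n = "card {w. w < 2 ^ t \<and> covered e j t w}"
  have "emeasure lam (stage e j t) = ennreal (?n * (1/2) ^ t)"
    unfolding stage_eq_blocks by (rule emeasure_blocks) auto
  moreover have "?n * (1/2) ^ t \<le> (1/2 :: real) ^ j \<longleftrightarrow> real (?n * 2 ^ j) \<le> real (2 ^ t)"
    by (simp add: power_one_over divide_simps)
  ultimately show ?thesis unfolding small_def of_nat_le_iff by simp
qed

text \<open>For finite nonempty \<open>S\<close> the union is its last set; for infinite
  \<open>S\<close> it is the union of the whole chain, and continuity from below applies. With
  \<open>S\<close> the stages passing \<open>small\<close>, a cut-off component keeps its measure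
  bound.\<close>

lemma emeasure_UN_incseq_le:
  assumes inc: "incseq A" and meas: "\<And>t. A t \<in> sets M" and le: "\<And>t. t \<in> S \<Longrightarrow> emeasure M (A t) \<le> c"
  shows "emeasure M (\<Union>t\<in>S. A t) \<le> c"
proof (cases "finite S")
  case True
  show ?thesis
  proof (cases "S = {}")
    case False
    have "(\<Union>t\<in>S. A t) = A (Max S)"
    proof
      show "(\<Union>t\<in>S. A t) \<subseteq> A (Max S)" using True by (intro UN_least incseqD[OF inc] Max_ge)
      show "A (Max S) \<subseteq> (\<Union>t\<in>S. A t)" using True False by (intro UN_upper Max_in)
    qed
    then show ?thesis using le Max_in[OF True False] by simp
  qed simp
next
  case False
  then have ex: "\<exists>s\<in>S. t \<le> s" for t by (meson infinite_nat_iff_unbounded_le)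
  have "(\<Union>t\<in>S. A t) = (\<Union>t. A t)" using ex incseqD[OF inc] by blast
  also have "emeasure M (\<Union>t. A t) = (SUP t. emeasure M (A t))"
    using inc meas by (intro SUP_emeasure_incseq[symmetric]) auto
  also have "\<dots> \<le> c"
  proof (rule SUP_least)
    fix t
    obtain s where "s \<in> S" "t \<le> s" using ex by blast
    then show "emeasure M (A t) \<le> c"
      using le[of s] emeasure_mono[OF incseqD[OF inc, of t s] meas] by (meson order_trans)
  qed
  finally show ?thesis .
qed

text \<open>Candidate \<open>e\<close> contributes its cut-off component \<open>i + e + 1\<close>,
  of measure at most \<open>(1/2) ^ (i + e + 1)\<close>; these bounds sum to
  \<open>(1/2) ^ i\<close>.\<close>

definition universal_test :: "nat \<Rightarrow> cantor set" where
  "universal_test i = (\<Union>\<sigma>\<in>{\<sigma>. \<exists>e t. small e (i + e + 1) t \<and> hit e (i + e + 1) t (code_str \<sigma>)}. cyl \<sigma>)"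

lemma universal_test_eq: "universal_test i = (\<Union>e. \<Union>t\<in>{t. small e (i + e + 1) t}. stage e (i + e + 1) t)"
  unfolding universal_test_def stage_def by blast

lemma unif_eff_open_universal_test: "unif_eff_open universal_test"
proof -
  have small: "decp (\<lambda>z. small (pfst z) (pfst (psnd z)) (psnd (psnd z)))"
    unfolding small_def covered_def hit_def by (intro rec_intros)
  have small': "decp (\<lambda>z. small (e z) (i z) (t z))" if "rec1 e" "rec1 i" "rec1 t" for e i t
    using decp_comp[OF small, of "\<lambda>z. pair (e z) (pair (i z) (t z))"] that
    by (simp add: rec_intros)
  then have "sigma1 (\<lambda>z. \<exists>t e. small e (pfst z + e + 1) t \<and> hit e (pfst z + e + 1) t (psnd z))"
    unfolding hit_def by (intro sigma1_ex sigma1_decp small' rec_intros)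
  then have "sigma1 (\<lambda>z. \<exists>e t. small e (pfst z + e + 1) t \<and> hit e (pfst z + e + 1) t (psnd z))"
    by (subst ex_comm)
  then show ?thesis unfolding universal_test_def[abs_def] by (rule unif_eff_open_sigma1)
qed

lemma emeasure_universal_test: "emeasure lam (universal_test i) \<le> ennreal ((1/2) ^ i)"
proof -
  let ?G = "\<lambda>e. \<Union>t\<in>{t. small e (i + e + 1) t}. stage e (i + e + 1) t"
  have "emeasure lam (?G e) \<le> ennreal ((1/2) ^ (i + e + 1))" for e
    by (rule emeasure_UN_incseq_le[OF incseq_stage]) (auto simp: small_iff)
  moreover have "emeasure lam (universal_test i) \<le> (\<Sum>e. emeasure lam (?G e))"
    unfolding universal_test_eq by (rule emeasure_subadditive_countably) auto
  ultimately have "emeasure lam (universal_test i) \<le> (\<Sum>e. ennreal ((1/2) ^ (i + e + 1)))"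
    by (meson order_trans suminf_le summableI)
  also have "\<dots> = ennreal ((1/2) ^ i)"
  proof (rule suminf_ennreal_eq)
    show "(\<lambda>e. (1/2 :: real) ^ (i + e + 1)) sums (1/2) ^ i"
      using sums_mult[OF power_half_series, of "(1/2) ^ i"] by (simp add: power_add)
  qed simp
  finally show ?thesis .
qed

lemma mltest_universal_test: "mltest universal_test"
  unfolding mltest_def using unif_eff_open_universal_test emeasure_universal_test by blast

text \<open>Let \<open>e\<close> code a program enumerating the genuine test \<open>V\<close>. Its
  stages all pass \<open>small\<close>, so nothing is cut off and \<open>V (i + e + 1)\<close> lies
  inside \<open>universal_test i\<close>.\<close>

lemma mltest_le_universal_test:
  assumes "mltest V" shows "(\<Inter>i. V i) \<subseteq> universal_test i"
proof -
  have V: "unif_eff_open V" "\<And>i. emeasure lam (V i) \<le> ennreal ((1/2) ^ i)"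
    using assms by (auto simp: mltest_def)
  then obtain f where f: "\<And>n. (n \<in> {prod_encode (i, code_str \<sigma>) |i \<sigma>. cyl \<sigma> \<subseteq> V i}) \<longleftrightarrow> (\<exists>y. ev0 f [n] y)"
    unfolding unif_eff_open_def ce_def by blast
  define e where "e = enc f"
  define j where "j = i + e + 1"
  have T: "cyl \<sigma> \<subseteq> V j \<longleftrightarrow> (\<exists>d. kleeneT e (pair j (code_str \<sigma>)) d)" for \<sigma>
    using f[of "pair j (code_str \<sigma>)"] inj_code_str
    by (auto simp: kleeneT[symmetric] e_def pair_def dest: injD)
  have sub: "stage e j t \<subseteq> V j" for t
    unfolding stage_def hit_def using T by blast
  have op: "cantor_open (V j)" using V(1) by (simp add: unif_eff_open_def)
  have small: "small e j t" for t
    unfolding small_iff using emeasure_mono[OF sub sets_cantor_open[OF op]] V(2) by (meson order_trans)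
  show ?thesis
  proof
    fix X assume "X \<in> (\<Inter>i. V i)"
    then have "X \<in> V j" by blast
    then obtain \<sigma> where \<sigma>: "X \<in> cyl \<sigma>" "cyl \<sigma> \<subseteq> V j" using op unfolding cantor_open_def by blast
    then obtain d where "kleeneT e (pair j (code_str \<sigma>)) d" using T by blast
    then have "hit e j (Suc (max d (code_str \<sigma>))) (code_str \<sigma>)"
      unfolding hit_def by (auto intro!: exI[of _ d])
    then show "X \<in> universal_test i" unfolding universal_test_def j_def using small[unfolded j_def] \<sigma>(1) by blast
  qed
qed

lemma universal_mltest_universal_test: "universal_mltest universal_test"
  unfolding universal_mltest_def using mltest_universal_test mltest_le_universal_test by blast

section \<open>The test of sibling cylinders\<close>

definition siblings :: "cantor set \<Rightarrow> cantor set" where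
  "siblings V = (\<Union>\<rho>\<in>{\<rho>. cyl (\<rho> @ [False]) \<subseteq> V}. cyl (\<rho> @ [True]))"

lemma cyl_take: "cyl \<sigma> \<subseteq> cyl (take k \<sigma>)"
  by (auto simp: cyl_def)

text \<open>Splitting \<open>V\<close> into its maximal cylinders, only those of the form \<open>\<rho>0\<close> have a sibling
  outside \<open>V\<close>, and that sibling has the same measure.\<close>

lemma emeasure_siblings:
  assumes V: "cantor_open V" shows "emeasure lam (siblings V) \<le> 2 * emeasure lam V"
proof -
  \<comment> \<open>The strings \<rho> of length \<open>n\<close> whose left child has its cylinder
    in \<open>V\<close>, while neither \<rho> nor any prefix of \<rho> does.\<close>
  define M where "M n = {\<rho>. length \<rho> = n \<and> cyl (\<rho> @ [False]) \<subseteq> V \<and> (\<forall>k\<le>n. \<not> cyl (take k \<rho>) \<subseteq> V)}" for n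
  define B where "B b n = (\<Union>\<rho>\<in>M n. cyl (\<rho> @ [b]))" for b n
  have fin: "finite (M n)" for n
    by (rule finite_subset[OF _ finite_lists_length_eq[of "UNIV :: bool set" n]]) (auto simp: M_def)
  have sets_B: "B b n \<in> sets lam" for b n unfolding B_def using fin by auto
  have VM: "V \<in> sets lam" using V by (rule sets_cantor_open)
  have "siblings V \<subseteq> V \<union> (\<Union>n. B True n)"
  proof
    fix X assume "X \<in> siblings V"
    then obtain \<rho> where \<rho>: "cyl (\<rho> @ [False]) \<subseteq> V" "X \<in> cyl (\<rho> @ [True])" by (auto simp: siblings_def)
    show "X \<in> V \<union> (\<Union>n. B True n)"
    proof (cases "\<rho> \<in> M (length \<rho>)")
      case True
      then show ?thesis using \<rho>(2) by (auto simp: B_def)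
    next
      \<comment> \<open>Some prefix of \<rho>, possibly \<rho> itself, already has its cylinder in
        \<open>V\<close>, and then \<open>V\<close> contains the right child as well.\<close>
      case False
      then obtain k where k: "cyl (take k \<rho>) \<subseteq> V" using \<rho>(1) by (auto simp: M_def)
      have "cyl (\<rho> @ [True]) \<subseteq> cyl \<rho>" using cyl_append1 by blast
      then show ?thesis using k \<rho>(2) cyl_take by blast
    qed
  qed
  then have "emeasure lam (siblings V) \<le> emeasure lam (V \<union> (\<Union>n. B True n))"
    using VM sets_B by (intro emeasure_mono) auto
  also have "\<dots> \<le> emeasure lam V + emeasure lam (\<Union>n. B True n)"
    using VM sets_B by (intro emeasure_subadditive) auto
  also have "emeasure lam (\<Union>n. B True n) \<le> emeasure lam V"
  proof -
    have "emeasure lam (B True n) \<le> emeasure lam (B False n)" for n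
    proof -
      have "emeasure lam (B True n) \<le> (\<Sum>\<rho>\<in>M n. emeasure lam (cyl (\<rho> @ [True])))"
        unfolding B_def using fin by (intro emeasure_subadditive_finite) auto
      also have "\<dots> = (\<Sum>\<rho>\<in>M n. emeasure lam (cyl (\<rho> @ [False])))" by (simp add: emeasure_cyl)
      also have "\<dots> = emeasure lam (B False n)"
        unfolding B_def
      proof (rule sum_emeasure)
        show "disjoint_family_on (\<lambda>\<rho>. cyl (\<rho> @ [False])) (M n)"
          unfolding disjoint_family_on_def
        proof (intro ballI impI)
          fix \<rho> \<tau> assume *: "\<rho> \<in> M n" "\<tau> \<in> M n" "\<rho> \<noteq> \<tau>"
          show "cyl (\<rho> @ [False]) \<inter> cyl (\<tau> @ [False]) = {}"
          proof (rule ccontr)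
            assume "\<not> ?thesis"
            then obtain X where "X \<in> cyl (\<rho> @ [False])" "X \<in> cyl (\<tau> @ [False])" by blast
            moreover have "length \<rho> = n" "length \<tau> = n" using *(1,2) by (auto simp: M_def)
            ultimately have "\<rho> @ [False] = \<tau> @ [False]"
              using cyl_prefix[of X "\<rho> @ [False]"] cyl_prefix[of X "\<tau> @ [False]"] by simp
            then show False using *(3) by simp
          qed
        qed
      qed (use fin in auto)
      finally show ?thesis .
    qed
    then have "(\<Sum>n. emeasure lam (B True n)) \<le> (\<Sum>n. emeasure lam (B False n))"
      by (intro suminf_le summableI)
    also have "\<dots> = emeasure lam (\<Union>n. B False n)"
    proof (rule suminf_emeasure)
      \<comment> \<open>If the two met, the left child of \<rho> would be a prefix of \<tau> with
        its cylinder in \<open>V\<close>, which \<open>M m\<close> excludes.\<close>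
      have "B False n \<inter> B False m = {}" if "n < m" for n m
      proof (rule ccontr)
        assume "\<not> ?thesis"
        then obtain X \<rho> \<tau> where *: "\<rho> \<in> M n" "\<tau> \<in> M m" "X \<in> cyl (\<rho> @ [False])" "X \<in> cyl (\<tau> @ [False])"
          by (auto simp: B_def)
        then have len: "length \<rho> = n" "length \<tau> = m" by (auto simp: M_def)
        have "\<rho> @ [False] = map X [0..<Suc n]" using cyl_prefix[OF *(3)] len by simp
        also have "\<dots> = take (Suc n) (map X [0..<Suc m])" using that by (simp add: take_map del: upt_Suc)
        also have "\<dots> = take (Suc n) \<tau>" using cyl_prefix[OF *(4)] len that by simp
        finally have "cyl (take (Suc n) \<tau>) \<subseteq> V" using *(1) by (simp add: M_def)
        then show False using *(2) that by (auto simp: M_def)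
      qed
      then show "disjoint_family (B False)"
        unfolding disjoint_family_on_def by (metis Int_commute linorder_neqE_nat)
    qed (use sets_B in auto)
    also have "\<dots> \<le> emeasure lam V"
      using VM by (intro emeasure_mono) (auto simp: B_def M_def)
    finally show ?thesis
      using emeasure_subadditive_countably[of "B True" lam] sets_B by (meson image_subsetI order_trans)
  qed
  finally show ?thesis by (simp add: mult_2 add_left_mono)
qed

text \<open>The sibling relation on codes is decidable, which gives effectiveness; the shift to
  \<open>Suc i\<close> absorbs the factor 2 of \<open>emeasure_siblings\<close>.\<close>

lemma mltest_siblings:
  assumes V: "mltest V" shows "mltest (\<lambda>i. siblings (V (Suc i)))"
proof -
  have op: "unif_eff_open V" "\<And>i. cantor_open (V i)" "\<And>i. emeasure lam (V i) \<le> ennreal ((1/2) ^ i)"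
    using V by (auto simp: mltest_def unif_eff_open_def)
  define sib where "sib c c' \<longleftrightarrow> lenc c = lenc c' \<and> 0 < lenc c \<and>
    (\<forall>k<lenc c - 1. nthc c k = nthc c' k) \<and> nthc c (lenc c - 1) = 1 \<and> nthc c' (lenc c - 1) = 0" for c c'
  have sib: "sib (code_str \<tau>) (code_str \<sigma>) \<longleftrightarrow> (\<exists>\<rho>. \<tau> = \<rho> @ [True] \<and> \<sigma> = \<rho> @ [False])" for \<tau> \<sigma>
  proof
    assume s: "sib (code_str \<tau>) (code_str \<sigma>)"
    then have "\<tau> \<noteq> []" "\<sigma> \<noteq> []" "length \<tau> = length \<sigma>" by (auto simp: sib_def)
    then obtain \<rho> b \<rho>' b' where eq: "\<tau> = \<rho> @ [b]" "\<sigma> = \<rho>' @ [b']" "length \<rho> = length \<rho>'"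
      by (metis append_butlast_last_id length_butlast)
    have "\<rho> = \<rho>'"
      using s eq by (intro nth_equalityI) (auto simp: sib_def nth_append of_bool_eq_iff)
    moreover have "b" "\<not> b'" using s eq by (cases b; auto simp: sib_def nth_append)+
    ultimately show "\<exists>\<rho>. \<tau> = \<rho> @ [True] \<and> \<sigma> = \<rho> @ [False]" using eq by auto
  qed (auto simp: sib_def nth_append)
  define E where "E i c \<longleftrightarrow> (\<exists>c'. sib c c' \<and> (\<exists>\<sigma>. c' = code_str \<sigma> \<and> cyl \<sigma> \<subseteq> V (Suc i)))" for i c
  have V_sigma1: "sigma1 (\<lambda>n. \<exists>\<sigma>. psnd n = code_str \<sigma> \<and> cyl \<sigma> \<subseteq> V (pfst n))"
    using op(1) by (simp add: unif_eff_open_iff)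
  have "rec1 (\<lambda>z. pair (Suc (pfst (psnd z))) (pfst z))" by (intro rec_intros)
  from sigma1_comp[OF V_sigma1 this]
  have "sigma1 (\<lambda>z. \<exists>\<sigma>. pfst z = code_str \<sigma> \<and> cyl \<sigma> \<subseteq> V (Suc (pfst (psnd z))))" by simp
  moreover have "sigma1 (\<lambda>z. sib (psnd (psnd z)) (pfst z))"
    unfolding sib_def by (intro sigma1_decp rec_intros)
  ultimately have "sigma1 (\<lambda>z. E (pfst z) (psnd z))"
    unfolding E_def by (intro sigma1_ex sigma1_conj)
  then have "unif_eff_open (\<lambda>i. \<Union>\<sigma>\<in>{\<sigma>. E i (code_str \<sigma>)}. cyl \<sigma>)" by (rule unif_eff_open_sigma1)
  moreover have "E i (code_str \<tau>) \<longleftrightarrow> (\<exists>\<rho>. \<tau> = \<rho> @ [True] \<and> cyl (\<rho> @ [False]) \<subseteq> V (Suc i))" for i \<tau>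
    unfolding E_def by (metis sib)
  then have "{\<tau>. E i (code_str \<tau>)} = (\<lambda>\<rho>. \<rho> @ [True]) ` {\<rho>. cyl (\<rho> @ [False]) \<subseteq> V (Suc i)}" for i
    by auto
  then have "(\<Union>\<sigma>\<in>{\<sigma>. E i (code_str \<sigma>)}. cyl \<sigma>) = siblings (V (Suc i))" for i
    by (simp add: siblings_def)
  moreover have "emeasure lam (siblings (V (Suc i))) \<le> ennreal ((1/2) ^ i)" for i
  proof -
    have "emeasure lam (siblings (V (Suc i))) \<le> 2 * ennreal ((1/2) ^ Suc i)"
      using emeasure_siblings[OF op(2)] op(3) by (meson mult_left_mono order_trans zero_le)
    also have "\<dots> = ennreal (2 * (1/2) ^ Suc i)" by (subst ennreal_mult) auto
    finally show ?thesis by simp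
  qed
  ultimately show ?thesis by (simp add: mltest_def)
qed

text \<open>An eventually false sequence is computable, so the cylinders of its initial segments
  form a test capturing it. The lemma supplies right turns of \<open>P\<close> at arbitrary
  depth.\<close>

lemma MLR_not_eventually_False:
  assumes P: "P \<in> MLR" shows "\<exists>k\<ge>m. P k"
proof (rule ccontr)
  assume "\<not> ?thesis"
  then have m: "\<And>k. k \<ge> m \<Longrightarrow> \<not> P k" by blast
  define E where "E i c \<longleftrightarrow> lenc c = i \<and> (\<forall>k<i. nthc c k = nthc (code_str (map P [0..<m])) k)" for i c
  \<comment> \<open>From position \<open>m\<close> on, the default value 0 of \<open>nthc\<close>
    coincides with \<open>P\<close> being false, so one string code describes all of
    \<open>P\<close>.\<close>
  have nth: "nthc (code_str (map P [0..<m])) k = of_bool (P k)" for k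
    using m[of k] by (simp add: code_str_def nthc_encode)
  have "sigma1 (\<lambda>z. E (pfst z) (psnd z))"
    unfolding E_def by (intro sigma1_decp rec_intros)
  then have "unif_eff_open (\<lambda>i. \<Union>\<sigma>\<in>{\<sigma>. E i (code_str \<sigma>)}. cyl \<sigma>)" by (rule unif_eff_open_sigma1)
  moreover have "{\<sigma>. E i (code_str \<sigma>)} = {map P [0..<i]}" for i
    unfolding E_def nth by (auto intro!: nth_equalityI)
  ultimately have "unif_eff_open (\<lambda>i. cyl (map P [0..<i]))" by simp
  then have "mltest (\<lambda>i. cyl (map P [0..<i]))" by (simp add: mltest_def emeasure_cyl)
  moreover have "P \<in> (\<Inter>i. cyl (map P [0..<i]))" by (simp add: cyl_map)
  ultimately show False using P unfolding MLR_def by blast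
qed

section \<open>Layerwise computability\<close>

text \<open>The odd oracle positions hold the characteristic function of \<open>{rd U X}\<close>, so
  output bit \<open>k\<close> is the oracle's answer at \<open>2 * k + 1\<close>, a position found
  by doubling.\<close>

lemma rd_computable: "exactly_layerwise_computable U (\<lambda>X k. k = rd U X)"
proof -
  let ?Phi = "Comp Orc [Comp Succ [PrimRec Zero (Comp Succ [Comp Succ [Proj 0]])]]"
  have succ: "ev Z (Comp Succ [g]) xs (Suc y)" if "ev Z g xs y" for Z g xs y
    using ev_comp1[OF that, of Succ] ev_succ[of Z "[y]"] by (simp add: arg0_def)
  have double: "ev Z (PrimRec Zero (Comp Succ [Comp Succ [Proj 0]])) [k] (2 * k)" for Z k
    by (induction k) (auto intro!: ev_pr0 ev_zero ev_projI succ intro: ev_prS)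
  have Phi: "ev Z ?Phi [k] (if Z (2 * k + 1) then 1 else 0)" for Z k
    using ev_comp1[OF succ[OF double], of Z Orc] ev_orc[of Z "[2 * k + 1]"] by (simp add: arg0_def)
  have "pair_seq_nat X n (2 * k + 1) \<longleftrightarrow> k = n" for X n k by (simp add: pair_seq_nat_def)
  then have "tf_computes ?Phi (pair_seq_nat X n) (\<lambda>k. k = n)" for X n
    unfolding tf_computes_def using Phi[of "pair_seq_nat X n"] by simp
  then show ?thesis unfolding exactly_layerwise_computable_def by blast
qed

text \<open>Among points of equal deficiency the number half of the joined oracle is constant, so
  the use principle turns agreement on \<open>n\<close> bits into equal output at
  \<open>m\<close>.\<close>

lemma layerwise_continuous:
  assumes "exactly_layerwise_computable U F" and "X \<in> MLR"
  shows "\<exists>n. \<forall>Y\<in>MLR. rd U Y = rd U X \<longrightarrow> (\<forall>k<n. Y k = X k) \<longrightarrow> F Y m = F X m"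
proof -
  obtain Phi where Phi: "\<And>X. X \<in> MLR \<Longrightarrow> ev (pair_seq_nat X (rd U X)) Phi [m] (if F X m then 1 else 0)"
    using assms(1) unfolding exactly_layerwise_computable_def tf_computes_def by blast
  obtain n where n: "\<And>B. (\<forall>k<n. pair_seq_nat X (rd U X) k = B k) \<Longrightarrow> ev B Phi [m] (if F X m then 1 else 0)"
    using ev_finite_use[OF Phi[OF assms(2)]] by blast
  have "F Y m = F X m" if Y: "Y \<in> MLR" "rd U Y = rd U X" "\<forall>k<n. Y k = X k" for Y
  proof -
    have "ev (pair_seq_nat Y (rd U Y)) Phi [m] (if F X m then 1 else 0)"
      by (rule n) (use Y in \<open>auto simp: pair_seq_nat_def\<close>)
    from ev_deterministic[OF this Phi[OF Y(1)]] show ?thesis by (auto split: if_splits)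
  qed
  then show ?thesis by blast
qed

lemma not_in_universal_imp_MLR: "universal_mltest U \<Longrightarrow> X \<notin> U i \<Longrightarrow> X \<in> MLR"
  unfolding universal_mltest_def MLR_def by blast

text \<open>Intersecting only the components \<open>V (h i)\<close> can only enlarge the
  intersection, which preserves universality; \<open>i \<le> h i\<close> preserves the measure
  bounds.\<close>

lemma universal_mltest_reindex:
  assumes V: "universal_mltest V" and h: "rec1 h" "\<And>i. i \<le> h i"
  shows "universal_mltest (\<lambda>i. V (h i))"
proof -
  have "emeasure lam (V (h i)) \<le> ennreal ((1/2) ^ i)" for i
  proof -
    have "emeasure lam (V (h i)) \<le> ennreal ((1/2) ^ h i)"
      using V by (simp add: universal_mltest_def mltest_def)
    also have "\<dots> \<le> ennreal ((1/2) ^ i)"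
      by (intro ennreal_leI power_decreasing h) auto
    finally show ?thesis .
  qed
  then have "mltest (\<lambda>i. V (h i))"
    using V unif_eff_open_reindex[OF _ h(1)] by (simp add: universal_mltest_def mltest_def)
  then show ?thesis using V unfolding universal_mltest_def by blast
qed

theorem theorem4p10:
  shows "\<exists>U W (F :: cantor \<Rightarrow> cantor).
           universal_mltest U \<and> universal_mltest W \<and>
           exactly_layerwise_computable U F \<and> \<not> exactly_layerwise_computable W F"
proof -
  define V where "V = universal_test"
  have V: "universal_mltest V" "mltest V" "\<And>i. emeasure lam (V i) \<le> ennreal ((1/2) ^ i)"
    using universal_mltest_universal_test mltest_universal_test emeasure_universal_test by (auto simp: V_def)
  have op: "cantor_open (V i)" for i
    using V(2) by (simp add: mltest_def unif_eff_open_def)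
  have "\<not> UNIV \<subseteq> V 1"
  proof
    assume "UNIV \<subseteq> V 1"
    then have "emeasure lam (V 1) = 1"
      using prob_space.emeasure_space_1[OF prob_space_lam] by (simp add: top.extremum_unique)
    with V(3)[of 1] have "ennreal 1 \<le> ennreal ((1/2) ^ 1)" by simp
    then show False by (subst (asm) ennreal_le_iff) auto
  qed
  then have "\<not> cyl [] \<subseteq> V 1" by (simp add: cyl_def)
  moreover have "\<not> cyl (\<rho> @ [False]) \<subseteq> V 1 \<or> \<not> cyl (\<rho> @ [True]) \<subseteq> V 1" if "\<not> cyl \<rho> \<subseteq> V 1" for \<rho>
    using that cyl_append1[of \<rho>] by blast
  ultimately obtain P where P: "\<forall>n. \<not> cyl (map P [0..<n]) \<subseteq> V 1"
    and left: "\<forall>n. P n \<longrightarrow> cyl (map P [0..<n] @ [False]) \<subseteq> V 1"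
    using leftmost_path[of "\<lambda>\<rho>. \<not> cyl \<rho> \<subseteq> V 1"] by blast
  have "P \<notin> V 1" using P cantor_openE[OF op] by metis
  then have "P \<in> MLR" using V(1) by (rule not_in_universal_imp_MLR[rotated])
  then obtain j where j: "P \<notin> siblings (V (Suc j))"
    using mltest_siblings[OF V(2)] unfolding MLR_def by blast

  \<comment> \<open>With these indices \<open>U 1 = W 0 = V (Suc j)\<close>, so a point outside
    \<open>V (Suc j)\<close> has \<open>W\<close>-deficiency 0 and \<open>U\<close>-deficiency at
    most 1.\<close>
  define U where "U i = V (if i = 0 then 1 else j + i)" for i
  define W where "W i = V (Suc j + i)" for i
  have "universal_mltest U"
    unfolding U_def[abs_def] by (rule universal_mltest_reindex[OF V(1)]) (intro rec_intros, simp)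
  moreover have "universal_mltest W"
    unfolding W_def[abs_def] by (rule universal_mltest_reindex[OF V(1)]) (intro rec_intros, simp)
  moreover have "\<not> exactly_layerwise_computable W (\<lambda>X k. k = rd U X)"
  proof
    assume "exactly_layerwise_computable W (\<lambda>X k. k = rd U X)"
    \<comment> \<open>Output position 0 tells deficiency 0 from positive deficiency.\<close>
    from layerwise_continuous[OF this \<open>P \<in> MLR\<close>, of 0]
    obtain n where n: "\<And>Y. Y \<in> MLR \<Longrightarrow> rd W Y = rd W P \<Longrightarrow> (\<forall>k<n. Y k = P k) \<Longrightarrow> (0 = rd U Y) = (0 = rd U P)"
      by blast
    obtain m where m: "m \<ge> n" "P m" using MLR_not_eventually_False[OF \<open>P \<in> MLR\<close>] by blast
    have PT: "P \<in> cyl (map P [0..<m] @ [True])" using m(2) by (simp add: cyl_def nth_append less_Suc_eq)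
    then have "\<not> cyl (map P [0..<m] @ [False]) \<subseteq> V (Suc j)" using j by (auto simp: siblings_def)
    then obtain Y where Y: "Y \<in> cyl (map P [0..<m] @ [False])" "Y \<notin> V (Suc j)" by blast
    \<comment> \<open>Membership would put a whole initial cylinder of \<open>P\<close> into
      \<open>V (Suc j)\<close>. Inside it \<open>P\<close> turns right again, and the left sibling
      there would make \<open>P\<close> a member of \<open>siblings (V (Suc j))\<close>.\<close>
    have "P \<notin> V (Suc j)"
    proof
      assume "P \<in> V (Suc j)"
      with op obtain k where k: "cyl (map P [0..<k]) \<subseteq> V (Suc j)" by (rule cantor_openE)
      obtain l where l: "l \<ge> k" "P l" using MLR_not_eventually_False[OF \<open>P \<in> MLR\<close>] by blast
      have "cyl (map P [0..<l] @ [False]) \<subseteq> cyl (map P [0..<k])"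
        using l(1) by (auto simp: cyl_def nth_append)
      then have "map P [0..<l] \<in> {\<rho>. cyl (\<rho> @ [False]) \<subseteq> V (Suc j)}" using k by blast
      moreover have "P \<in> cyl (map P [0..<l] @ [True])"
        using l(2) by (simp add: cyl_def nth_append less_Suc_eq)
      ultimately show False using j unfolding siblings_def by blast
    qed
    then have "rd W P = 0" by (simp add: rd_def W_def)
    moreover have "rd W Y = 0" using Y(2) by (simp add: rd_def W_def)
    moreover have "rd U P = 0" using \<open>P \<notin> V 1\<close> by (simp add: rd_def U_def)
    moreover have "rd U Y \<noteq> 0"
    proof
      assume "rd U Y = 0"
      moreover have "Y \<notin> U (rd U Y)"
        unfolding rd_def by (rule LeastI[of _ 1]) (use Y(2) in \<open>simp add: U_def\<close>)
      ultimately have "Y \<notin> V 1" by (simp add: U_def)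
      \<comment> \<open>\<open>P\<close> turns right at \<open>m\<close>, so \<open>left\<close>
        places the cylinder containing \<open>Y\<close> inside \<open>V 1\<close>.\<close>
      then show False using Y(1) left m(2) by blast
    qed
    moreover have "\<forall>k<n. Y k = P k" using Y(1) m(1) by (auto simp: cyl_def nth_append)
    moreover have "Y \<in> MLR" using V(1) Y(2) by (rule not_in_universal_imp_MLR)
    ultimately show False using n by metis
  qed
  ultimately show ?thesis using rd_computable by blast
qed

end
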